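(* Let $n\ge5$ be odd, let $E$ be the matrix in the context, $P=I_{2n-1}-\frac{1}{2n-1}J_{2n-1}$ and $U=-\frac12PEP$. Then $L_{odd}=U^\dagger$.
   Context: $\mathbf{1}_p$ all-ones vector in $\mathbb{R}^p$, $J_p=\mathbf{1}_p\mathbf{1}_p'$, $I_p$ identity, $O$ zero matrix, $X'$ transpose, $X^\dagger$ Moore–Penrose inverse. $\mathrm{Circ}(a_1,\dots,a_p)$ is the circulant matrix with first row $(a_1,\dots,a_p)$, each subsequent row the previous one shifted cyclically one position to the right. $S=\mathrm{Circ}(1,3,\dots,3,1)$ (size $n-1$, $n-3$ threes), $T=\mathrm{Circ}(0,2,4,\dots,4,2)$ (size $n-1$, $n-4$ fours), \[E=\begin{bmatrix}0&\mathbf{1}_{n-1}'&2\mathbf{1}_{n-1}'\\ \mathbf{1}_{n-1}&2(J_{n-1}-I_{n-1})&S\\ 2\mathbf{1}_{n-1}&S'&T\end{bmatrix}\] (distance matrix of the gear graph on $2n-1$ vertices). Let $\phi_k=\cos(\frac{\pi k}{n-1})$, $C_k=\mathrm{Circ}(1,\cos\frac{2\pi k}{n-1},\dots,\cos\frac{2\pi(n-2)k}{n-1})$, $\widetilde{C_k}=\mathrm{Circ}(\cos\frac{2\pi k}{n-1},\dots,\cos\frac{2\pi(n-2)k}{n-1},1)$, \[A=\frac{9(n-1)}{(n+4)^2}\begin{bmatrix}1&\frac{n-2}{3(n-1)}\mathbf{1}_{n-1}'&\frac{-(n+1)}{3(n-1)}\mathbf{1}_{n-1}'\\ \frac{n-2}{3(n-1)}\mathbf{1}_{n-1}&\frac{(n-2)^2}{9(n-1)^2}J_{n-1}&\frac{-(n-2)(n+1)}{9(n-1)^2}J_{n-1}\\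 \frac{-(n+1)}{3(n-1)}\mathbf{1}_{n-1}&\frac{-(n-2)(n+1)}{9(n-1)^2}J_{n-1}&\frac{(n+1)^2}{9(n-1)^2}J_{n-1}\end{bmatrix},\] for $\phi_k\ne0$ \[B_k=\frac{2}{(n-1)(2\phi_k+\frac{1}{2\phi_k})^2}\begin{bmatrix}0&\mathbf{0}&\mathbf{0}\\ \mathbf{0}&\frac{C_k}{4\phi_k^2}&\frac{C_k+\widetilde{C_k}}{4\phi_k^2}\\ \mathbf{0}&\frac{C_k+\widetilde{C_k}'}{4\phi_k^2}&C_k\end{bmatrix},\] $H=\frac{1}{n-1}\begin{bmatrix}0&\mathbf{0}'&\mathbf{0}'\\ \mathbf{0}&R&O\\ \mathbf{0}&O&O\end{bmatrix}$ with $R(r,s)=(-1)^{r+s}$, and $L_{odd}=A+H+\sum_{k=1}^{(n-3)/2}B_k$. *)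

theory Defs
  imports Complex_Main "Jordan_Normal_Form.Matrix"
begin

text \<open>The Moore--Penrose inverse of a real matrix, via the four Penrose equations.
  Such a matrix is unique (see below), so the description is well defined whenever a
  solution exists.\<close>

definition is_mp_inverse :: "real mat \<Rightarrow> real mat \<Rightarrow> bool" where
  "is_mp_inverse A X \<longleftrightarrow>
     X \<in> carrier_mat (dim_col A) (dim_row A) \<and>
     A * X * A = A \<and>
     X * A * X = X \<and>
     transpose_mat (A * X) = A * X \<and>
     transpose_mat (X * A) = X * A"

definition mp_inverse :: "real mat \<Rightarrow> real mat" where
  "mp_inverse A = (THE X. is_mp_inverse A X)"

lemma is_mp_inverse_unique:
  assumes X: "is_mp_inverse A X" and Y: "is_mp_inverse A Y"
  shows "X = Y"
proof -
  define r c where "r = dim_row A" and "c = dim_col A"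
  have A: "A \<in> carrier_mat r c" by (simp add: r_def c_def)
  have Xc: "X \<in> carrier_mat c r" and Yc: "Y \<in> carrier_mat c r"
    using X Y by (simp_all add: is_mp_inverse_def r_def c_def)
  have AX: "A * X \<in> carrier_mat r r" and AY: "A * Y \<in> carrier_mat r r"
    and XA: "X * A \<in> carrier_mat c c" and YA: "Y * A \<in> carrier_mat c c"
    using mult_carrier_mat A Xc Yc by blast+
  have "A * X = (A * Y * A) * X"
    using Y by (simp add: is_mp_inverse_def)
  also have "\<dots> = (A * Y) * (A * X)"
    by (rule assoc_mult_mat[OF AY A Xc])
  finally have 1: "A * X = (A * Y) * (A * X)" .
  have "A * X = transpose_mat (A * X)"
    using X by (simp add: is_mp_inverse_def)
  also have "\<dots> = transpose_mat (A * X) * transpose_mat (A * Y)"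
    by (subst 1) (rule transpose_mult[OF AY AX])
  also have "\<dots> = (A * X) * (A * Y)"
    using X Y by (simp add: is_mp_inverse_def)
  also have "\<dots> = (A * X * A) * Y"
    by (rule assoc_mult_mat[OF AX A Yc, symmetric])
  also have "\<dots> = A * Y"
    using X by (simp add: is_mp_inverse_def)
  finally have AXY: "A * X = A * Y" .
  have "X * A = X * (A * Y * A)"
    using Y by (simp add: is_mp_inverse_def)
  also have "\<dots> = X * (A * (Y * A))"
    by (simp only: assoc_mult_mat[OF A Yc A])
  also have "\<dots> = (X * A) * (Y * A)"
    by (rule assoc_mult_mat[OF Xc A YA, symmetric])
  finally have 2: "X * A = (X * A) * (Y * A)" .
  have "X * A = transpose_mat (X * A)"
    using X by (simp add: is_mp_inverse_def)
  also have "\<dots> = transpose_mat (Y * A) * transpose_mat (X * A)"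
    by (subst 2) (rule transpose_mult[OF XA YA])
  also have "\<dots> = (Y * A) * (X * A)"
    using X Y by (simp add: is_mp_inverse_def)
  also have "\<dots> = Y * (A * (X * A))"
    by (rule assoc_mult_mat[OF Yc A XA])
  also have "\<dots> = Y * (A * X * A)"
    by (simp only: assoc_mult_mat[OF A Xc A])
  also have "\<dots> = Y * A"
    using X by (simp add: is_mp_inverse_def)
  finally have XYA: "X * A = Y * A" .
  have "X = X * A * X"
    using X by (simp add: is_mp_inverse_def)
  also have "\<dots> = Y * (A * X)"
    unfolding XYA by (rule assoc_mult_mat[OF Yc A Xc])
  also have "\<dots> = Y * A * Y"
    unfolding AXY by (rule assoc_mult_mat[OF Yc A Yc, symmetric])
  also have "\<dots> = Y"
    using Y by (simp add: is_mp_inverse_def)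
  finally show ?thesis .
qed

lemma mp_inverse_eqI: "is_mp_inverse A X \<Longrightarrow> mp_inverse A = X"
  unfolding mp_inverse_def by (blast intro: is_mp_inverse_unique)

definition ones_mat :: "nat \<Rightarrow> nat \<Rightarrow> real mat" where
  "ones_mat r c = mat r c (\<lambda>_. 1)"

abbreviation J_mat :: "nat \<Rightarrow> real mat" where
  "J_mat p \<equiv> ones_mat p p"

text \<open>The circulant matrix with the given first row; the lemmas below say that every
  further row is the previous one shifted cyclically one position to the right.\<close>

definition circ :: "real list \<Rightarrow> real mat" where
  "circ a = (let p = length a in mat p p (\<lambda>(i, j). a ! ((j + p - i) mod p)))"

lemma circ_index:
  assumes "i < length a" and "j < length a"
  shows "circ a $$ (i, j) = a ! ((j + length a - i) mod length a)"
  using assms unfolding circ_def Let_def by (subst index_mat) auto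

lemma circ_first_row: "j < length a \<Longrightarrow> circ a $$ (0, j) = a ! j"
  by (subst circ_index) auto

lemma circ_shift:
  "Suc i < length a \<Longrightarrow> Suc j < length a \<Longrightarrow> circ a $$ (Suc i, Suc j) = circ a $$ (i, j)"
  by (simp add: circ_index)

lemma circ_shift_wrap:
  assumes "Suc i < length a"
  shows "circ a $$ (Suc i, 0) = circ a $$ (i, length a - 1)"
proof -
  have "length a - 1 + length a - i = length a - Suc i + length a"
    using assms by simp
  moreover have "0 < length a" "i < length a" "length a - 1 < length a"
    using assms by linarith+
  ultimately show ?thesis
    using assms by (simp only: circ_index mod_add_self2 add_0)
qed

definition nine_block_mat ::
  "real mat \<Rightarrow> real mat \<Rightarrow> real mat \<Rightarrow>
   real mat \<Rightarrow> real mat \<Rightarrow> real mat \<Rightarrow>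
   real mat \<Rightarrow> real mat \<Rightarrow> real mat \<Rightarrow> real mat" where
  "nine_block_mat M11 M12 M13 M21 M22 M23 M31 M32 M33 =
     four_block_mat
       (four_block_mat M11 M12 M21 M22)
       (four_block_mat M13 (0\<^sub>m (dim_row M13) 0) M23 (0\<^sub>m (dim_row M23) 0))
       (four_block_mat M31 M32 (0\<^sub>m 0 (dim_col M31)) (0\<^sub>m 0 (dim_col M32)))
       M33"

definition S_mat :: "nat \<Rightarrow> real mat" where
  "S_mat n = circ ([1] @ replicate (n - 3) 3 @ [1])"

definition T_mat :: "nat \<Rightarrow> real mat" where
  "T_mat n = circ ([0, 2] @ replicate (n - 4) 4 @ [2])"

definition E_mat :: "nat \<Rightarrow> real mat" where
  "E_mat n = nine_block_mat
     (0\<^sub>m 1 1)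
       (ones_mat 1 (n - 1))
         (2 \<cdot>\<^sub>m ones_mat 1 (n - 1))
     (ones_mat (n - 1) 1)
       (2 \<cdot>\<^sub>m (J_mat (n - 1) - 1\<^sub>m (n - 1)))
         (S_mat n)
     (2 \<cdot>\<^sub>m ones_mat (n - 1) 1)
       (transpose_mat (S_mat n))
         (T_mat n)"

definition phi :: "nat \<Rightarrow> nat \<Rightarrow> real" where
  "phi n k = cos (pi * real k / (real n - 1))"

definition C_mat :: "nat \<Rightarrow> nat \<Rightarrow> real mat" where
  "C_mat n k =
     circ ([1] @ map (\<lambda>j. cos (2 * pi * real j * real k / (real n - 1))) [1..<n - 1])"

definition C_tilde_mat :: "nat \<Rightarrow> nat \<Rightarrow> real mat" where
  "C_tilde_mat n k =
     circ (map (\<lambda>j. cos (2 * pi * real j * real k / (real n - 1))) [1..<n - 1] @ [1])"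

definition A_mat :: "nat \<Rightarrow> real mat" where
  "A_mat n = (9 * (real n - 1) / (real n + 4)\<^sup>2) \<cdot>\<^sub>m nine_block_mat
     (1\<^sub>m 1)
       (((real n - 2) / (3 * (real n - 1))) \<cdot>\<^sub>m ones_mat 1 (n - 1))
         ((- (real n + 1) / (3 * (real n - 1))) \<cdot>\<^sub>m ones_mat 1 (n - 1))
     (((real n - 2) / (3 * (real n - 1))) \<cdot>\<^sub>m ones_mat (n - 1) 1)
       (((real n - 2)\<^sup>2 / (9 * (real n - 1)\<^sup>2)) \<cdot>\<^sub>m J_mat (n - 1))
         ((- (real n - 2) * (real n + 1) / (9 * (real n - 1)\<^sup>2)) \<cdot>\<^sub>m J_mat (n - 1))
     ((- (real n + 1) / (3 * (real n - 1))) \<cdot>\<^sub>m ones_mat (n - 1) 1)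
       ((- (real n - 2) * (real n + 1) / (9 * (real n - 1)\<^sup>2)) \<cdot>\<^sub>m J_mat (n - 1))
         (((real n + 1)\<^sup>2 / (9 * (real n - 1)\<^sup>2)) \<cdot>\<^sub>m J_mat (n - 1))"

text \<open>Only meaningful for \<^term>\<open>phi n k \<noteq> 0\<close>, which holds for \<open>1 \<le> k \<le> (n - 3) / 2\<close>.\<close>

definition B_mat :: "nat \<Rightarrow> nat \<Rightarrow> real mat" where
  "B_mat n k =
     (2 / ((real n - 1) * (2 * phi n k + 1 / (2 * phi n k))\<^sup>2)) \<cdot>\<^sub>m nine_block_mat
     (0\<^sub>m 1 1)
       (0\<^sub>m 1 (n - 1))
         (0\<^sub>m 1 (n - 1))
     (0\<^sub>m (n - 1) 1)
       ((1 / (4 * (phi n k)\<^sup>2)) \<cdot>\<^sub>m C_mat n k)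
         ((1 / (4 * (phi n k)\<^sup>2)) \<cdot>\<^sub>m (C_mat n k + C_tilde_mat n k))
     (0\<^sub>m (n - 1) 1)
       ((1 / (4 * (phi n k)\<^sup>2)) \<cdot>\<^sub>m (C_mat n k + transpose_mat (C_tilde_mat n k)))
         (C_mat n k)"

text \<open>Indices start at 0 here, which leaves the parity of \<open>r + s\<close> unchanged.\<close>

definition R_mat :: "nat \<Rightarrow> real mat" where
  "R_mat n = mat (n - 1) (n - 1) (\<lambda>(r, s). (-1) ^ (r + s))"

definition H_mat :: "nat \<Rightarrow> real mat" where
  "H_mat n = (1 / (real n - 1)) \<cdot>\<^sub>m nine_block_mat
     (0\<^sub>m 1 1)
       (0\<^sub>m 1 (n - 1))
         (0\<^sub>m 1 (n - 1))
     (0\<^sub>m (n - 1) 1)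
       (R_mat n)
         (0\<^sub>m (n - 1) (n - 1))
     (0\<^sub>m (n - 1) 1)
       (0\<^sub>m (n - 1) (n - 1))
         (0\<^sub>m (n - 1) (n - 1))"

text \<open>The sum of the matrices \<open>B_mat n k\<close> is written entrywise, since matrices of
  varying dimension do not form an additive monoid type.\<close>

definition L_odd :: "nat \<Rightarrow> real mat" where
  "L_odd n = A_mat n + H_mat n +
     mat (2 * n - 1) (2 * n - 1) (\<lambda>(i, j). \<Sum>k = 1..(n - 3) div 2. B_mat n k $$ (i, j))"

end

theory Submission
  imports Defs
begin

text \<open>Put \<open>m = n - 1\<close> and \<open>N = 2 n - 1\<close>. Up to terms of the form \<open>u 1' + 1 u'\<close>, which the
  centring \<open>P\<close> kills, \<open>E\<close> equals \<open>- 2 G G'\<close> with \<open>G = [0; I; W']\<close> and \<open>W\<close> the identity plus a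
  cyclic shift. Hence \<open>U = F F'\<close> with \<open>F = P G = G - (3 / N) J\<close>. The Gram matrix
  \<open>K = F' F\<close> is an invertible circulant, so \<open>U\<close> has the Moore-Penrose inverse \<open>F K\<^sup>-\<^sup>2 F'\<close>.
  The eigenvalue of \<open>K\<close> at frequency \<open>k \<noteq> 0\<close> is \<open>3 + 2 cos (2 \<pi> k / m) = 1 + 4 \<phi>\<^sub>k\<^sup>2\<close>, and it is
  \<open>(m + 5) / N\<close> at \<open>k = 0\<close>. Expanding \<open>F K\<^sup>-\<^sup>2 F'\<close> over frequencies, \<open>k = 0\<close> yields \<open>A\<close>,
  \<open>k = m / 2\<close> yields \<open>H\<close>, and each pair \<open>{k, m - k}\<close> yields \<open>B\<^sub>k\<close>.\<close>

section \<open>Moore-Penrose inverse of a Gram product\<close>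

text \<open>With K = F' F the hypothesis \<open>inv\<close> says K^2 Q = 1, so Q is K^(-2), and both
  products of the two matrices collapse to F K^(-1) F', which is symmetric. The right-nested form of
  \<open>inv\<close> lets an evaluation of F' (F M) be applied to it twice without
  reassociating.\<close>

lemma is_mp_inverse_gram:
  fixes F Q :: "real mat"
  assumes F: "F \<in> carrier_mat r c" and Q: "Q \<in> carrier_mat c c"
    and sym: "transpose_mat Q = Q"
    and inv: "transpose_mat F * (F * (transpose_mat F * (F * Q))) = 1\<^sub>m c"
  shows "is_mp_inverse (F * transpose_mat F) (F * Q * transpose_mat F)"
proof -
  define K where "K = transpose_mat F * F"
  have Ft: "transpose_mat F \<in> carrier_mat c r" using F by simp
  have K: "K \<in> carrier_mat c c" unfolding K_def using F by simp
  have KQ: "K * Q \<in> carrier_mat c c" using K Q by simp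
  have QK: "Q * K \<in> carrier_mat c c" using K Q by simp
  have symK: "transpose_mat K = K"
    unfolding K_def using transpose_mult[OF Ft F] by simp
  have "transpose_mat F * (F * (transpose_mat F * (F * Q))) = K * (K * Q)"
    unfolding K_def using F Ft Q
    by (simp add: assoc_mult_mat[of _ c r _ c _ c])
  with inv have KKQ: "K * (K * Q) = 1\<^sub>m c" by simp
  have QKK: "Q * K * K = 1\<^sub>m c"
  proof -
    have "transpose_mat (K * (K * Q)) = Q * K * K"
      using transpose_mult[OF K KQ] transpose_mult[OF K Q] by (simp add: symK sym)
    with KKQ show ?thesis by simp
  qed
  \<comment> \<open>\<open>Q * K\<close> is a left inverse of \<open>K\<close> and
    \<open>K * Q\<close> a right inverse, so they coincide.\<close>
  have comm: "Q * K = K * Q"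
  proof -
    have "Q * K = Q * K * (K * (K * Q))" using KKQ right_mult_one_mat[OF QK] by simp
    also have "\<dots> = Q * K * K * (K * Q)"
      by (rule assoc_mult_mat[OF QK K KQ, symmetric])
    also have "\<dots> = K * Q" using QKK left_mult_one_mat[OF KQ] by simp
    finally show ?thesis .
  qed
  have KQK: "K * Q * K = 1\<^sub>m c" using QKK comm by simp
  have FQ: "F * Q \<in> carrier_mat r c" using F Q by simp
  have UX: "F * transpose_mat F * (F * Q * transpose_mat F) = F * (K * Q) * transpose_mat F"
  proof -
    have "F * transpose_mat F * (F * Q * transpose_mat F) = F * (transpose_mat F * (F * Q * transpose_mat F))"
      by (rule assoc_mult_mat[OF F Ft mult_carrier_mat[OF FQ Ft]])
    also have "transpose_mat F * (F * Q * transpose_mat F) = transpose_mat F * (F * Q) * transpose_mat F"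
      by (rule assoc_mult_mat[OF Ft FQ Ft, symmetric])
    also have "transpose_mat F * (F * Q) = K * Q"
      unfolding K_def by (rule assoc_mult_mat[OF Ft F Q, symmetric])
    finally show ?thesis using assoc_mult_mat[OF F KQ Ft] by simp
  qed
  have XU: "F * Q * transpose_mat F * (F * transpose_mat F) = F * (Q * K) * transpose_mat F"
  proof -
    have "F * Q * transpose_mat F * (F * transpose_mat F) = F * Q * (transpose_mat F * (F * transpose_mat F))"
      by (rule assoc_mult_mat[OF FQ Ft mult_carrier_mat[OF F Ft]])
    also have "transpose_mat F * (F * transpose_mat F) = K * transpose_mat F"
      unfolding K_def by (rule assoc_mult_mat[OF Ft F Ft, symmetric])
    also have "F * Q * (K * transpose_mat F) = F * Q * K * transpose_mat F"
      by (rule assoc_mult_mat[OF FQ K Ft, symmetric])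
    also have "F * Q * K = F * (Q * K)" by (rule assoc_mult_mat[OF F Q K])
    finally show ?thesis .
  qed
  \<comment> \<open>Matrices of the form F M F' multiply through their middles, with K inserted; the
    first two Penrose equations become identities between K and Q.\<close>
  have sandwich: "F * M * transpose_mat F * (F * M' * transpose_mat F)
      = F * (M * K * M') * transpose_mat F"
    if M: "M \<in> carrier_mat c c" and M': "M' \<in> carrier_mat c c" for M M'
  proof -
    have FM: "F * M \<in> carrier_mat r c" and FM': "F * M' \<in> carrier_mat r c" using F M M' by auto
    have MK: "M * K \<in> carrier_mat c c" using M K by simp
    have "F * M * transpose_mat F * (F * M' * transpose_mat F)
       = F * M * (transpose_mat F * (F * M' * transpose_mat F))"
      by (rule assoc_mult_mat[OF FM Ft mult_carrier_mat[OF FM' Ft]])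
    also have "transpose_mat F * (F * M' * transpose_mat F) = transpose_mat F * (F * M') * transpose_mat F"
      by (rule assoc_mult_mat[OF Ft FM' Ft, symmetric])
    also have "transpose_mat F * (F * M') = K * M'"
      unfolding K_def by (rule assoc_mult_mat[OF Ft F M', symmetric])
    also have "F * M * (K * M' * transpose_mat F) = F * M * (K * M') * transpose_mat F"
      by (rule assoc_mult_mat[OF FM mult_carrier_mat[OF K M'] Ft, symmetric])
    also have "F * M * (K * M') = F * (M * K * M')"
      using assoc_mult_mat[OF F M, of "K * M'" c] assoc_mult_mat[OF M K M'] K M' by simp
    finally show ?thesis .
  qed
  have tr: "transpose_mat (F * (K * Q) * transpose_mat F) = F * (K * Q) * transpose_mat F"
  proof -
    have FKQ: "F * (K * Q) \<in> carrier_mat r c" using F KQ by simp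
    have "transpose_mat (F * (K * Q) * transpose_mat F) = F * (transpose_mat (K * Q) * transpose_mat F)"
      using transpose_mult[OF FKQ Ft] transpose_mult[OF F KQ] by simp
    also have "transpose_mat (K * Q) = K * Q"
      using transpose_mult[OF K Q] by (simp add: sym symK comm)
    finally show ?thesis using assoc_mult_mat[OF F KQ Ft] by simp
  qed
  have F1: "F * 1\<^sub>m c = F" using F by simp
  have UXU: "F * (K * Q) * transpose_mat F * (F * transpose_mat F) = F * transpose_mat F"
    using sandwich[OF KQ one_carrier_mat] KQK QK K Q by (simp add: F1)
  have XUX: "F * (Q * K) * transpose_mat F * (F * Q * transpose_mat F) = F * Q * transpose_mat F"
    using sandwich[OF QK Q] QKK Q by simp
  show ?thesis
    unfolding is_mp_inverse_def UX XU
    using UXU XUX tr F Q comm by simp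
qed

section \<open>Circulant matrices as cosine series\<close>

text \<open>The terms are the real parts of \<open>cis a\<close> times the powers of an
  \<open>m\<close>-th root of unity. As \<open>m\<close> does not divide \<open>d\<close>, that root
  is not 1, and its geometric sum over a full period vanishes.\<close>

lemma sum_cos_arith_progression_eq_0:
  fixes d :: int
  assumes "m > 0" and nd: "\<not> int m dvd d"
  shows "(\<Sum>j<m. cos (a + 2 * pi * of_int d * real j / real m)) = 0"
proof -
  define z where "z = cis (2 * pi * of_int d / real m)"
  have pow: "z ^ j = cis (2 * pi * of_int d * real j / real m)" for j
    unfolding z_def by (simp add: DeMoivre mult_ac)
  have "z ^ m = cis (2 * pi * of_int d)"
    unfolding pow using assms(1) by simp
  also have "\<dots> = 1" by (simp add: cis_multiple_2pi)
  finally have zm: "z ^ m = 1" .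
  have z1: "z \<noteq> 1"
  proof
    assume "z = 1"
    hence "cos (2 * pi * of_int d / real m) = 1" unfolding z_def by (metis cis.sel(1) one_complex.sel(1))
    then obtain k :: int where "2 * pi * of_int d / real m = of_int k * 2 * pi"
      using cos_one_2pi_int by blast
    hence "real_of_int d = of_int (int m * k)" using assms(1) by (simp add: field_simps)
    hence "d = int m * k" by linarith
    with nd show False by simp
  qed
  have "(\<Sum>j<m. z ^ j) = 0" using geometric_sum[OF z1, of m] zm by simp
  hence "Re (cis a * (\<Sum>j<m. z ^ j)) = 0" by simp
  moreover have "cis a * (\<Sum>j<m. z ^ j) = (\<Sum>j<m. cis (a + 2 * pi * of_int d * real j / real m))"
    unfolding sum_distrib_left pow by (simp add: cis_mult)
  ultimately show ?thesis by simp
qed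

lemma cos_freq_periodic:
  assumes "m > 0"
  shows "cos (2 * pi * real k * (x + real m) / real m) = cos (2 * pi * real k * x / real m)"
proof -
  have "2 * pi * real k * (x + real m) / real m = 2 * pi * real k * x / real m + 2 * pi * of_int (int k)"
    using assms by (simp add: field_simps)
  thus ?thesis
    by (simp only: cos_add cos_int_2pin sin_int_2pin mult_1_right mult_zero_right diff_0_right)
qed

text \<open>An inverse discrete Fourier transform: for a spectrum with \<mu> (m - k) = \<mu> k this
  is the entry at offset \<open>x\<close> of the circulant with eigenvalues \<mu>. The argument is
  real so that differences of indices can be inserted without reduction modulo
  \<open>m\<close>.\<close>

definition cos_series :: "nat \<Rightarrow> (nat \<Rightarrow> real) \<Rightarrow> real \<Rightarrow> real" where
  "cos_series m \<mu> x = (\<Sum>k<m. \<mu> k * cos (2 * pi * real k * x / real m)) / real m"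

lemma cos_series_periodic:
  "m > 0 \<Longrightarrow> cos_series m \<mu> (x + real m) = cos_series m \<mu> x"
  unfolding cos_series_def by (simp only: cos_freq_periodic)

lemma cos_series_minus: "cos_series m \<mu> (- x) = cos_series m \<mu> x"
  unfolding cos_series_def by simp

lemma cos_series_swap: "cos_series m \<mu> (x - y) = cos_series m \<mu> (y - x)"
  using cos_series_minus[of m \<mu> "x - y"] by simp

text \<open>Every nonconstant frequency cancels over a full period. All row and column sums of
  circulants below enter through this value.\<close>

lemma sum_cos_series:
  assumes m: "m > 0"
  shows "(\<Sum>l<m. cos_series m \<mu> (real l - a)) = \<mu> 0"
proof -
  have *: "(\<Sum>l<m. cos (2 * pi * real k * (real l - a) / real m)) = (if k = 0 then real m else 0)"
    if "k < m" for k
  proof (cases "k = 0")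
    case False
    with that have "\<not> int m dvd int k" using nat_dvd_not_less by auto
    from sum_cos_arith_progression_eq_0[OF m this, of "- (2 * pi * real k * a / real m)"]
    show ?thesis using False by (simp add: algebra_simps diff_divide_distrib)
  qed simp
  have "(\<Sum>l<m. cos_series m \<mu> (real l - a))
     = (\<Sum>k<m. \<mu> k * (\<Sum>l<m. cos (2 * pi * real k * (real l - a) / real m))) / real m"
    unfolding cos_series_def sum_divide_distrib[symmetric] sum_distrib_left by (subst sum.swap) simp
  also have "\<dots> = (\<Sum>k<m. if k = 0 then \<mu> 0 * real m else 0) / real m"
    using * by (intro arg_cong[of _ _ "\<lambda>t. t / real m"] sum.cong) auto
  also have "\<dots> = \<mu> 0" using m by simp
  finally show ?thesis .
qed

text \<open>By the addition formulas, summing over the two cyclic neighbours multiplies the spectrum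
  by the eigenvalues of the cycle on \<open>m\<close> vertices.\<close>

lemma cos_series_neighbours:
  "cos_series m \<mu> (x + 1) + cos_series m \<mu> (x - 1)
    = cos_series m (\<lambda>k. \<mu> k * (2 * cos (2 * pi * real k / real m))) x"
proof -
  have "\<mu> k * cos (2 * pi * real k * (x + 1) / real m) + \<mu> k * cos (2 * pi * real k * (x - 1) / real m)
     = \<mu> k * (2 * cos (2 * pi * real k / real m)) * cos (2 * pi * real k * x / real m)" for k
    by (simp add: distrib_left right_diff_distrib add_divide_distrib diff_divide_distrib cos_add cos_diff)
  thus ?thesis unfolding cos_series_def add_divide_distrib[symmetric] sum.distrib[symmetric] by simp
qed

text \<open>Orthogonality of characters: distinct indices below \<open>m\<close> differ by a
  non-multiple of \<open>m\<close>. Hence the constant spectrum 1 belongs to the identity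
  matrix.\<close>

lemma cos_series_kronecker:
  assumes "i < m" "j < m"
  shows "cos_series m (\<lambda>_. 1) (real i - real j) = of_bool (i = j)"
proof (cases "i = j")
  case False
  have "\<not> int m dvd (int i - int j)"
    using assms False zdvd_imp_le[of "int m" "int i - int j"] zdvd_imp_le[of "int m" "int j - int i"]
    by (cases "i < j") (auto simp: dvd_diff_commute)
  from sum_cos_arith_progression_eq_0[OF _ this, of 0] assms show ?thesis 
    using False by (simp add: cos_series_def mult_ac)
qed (use assms in \<open>simp add: cos_series_def\<close>)

lemma cos_series_lincomb:
  "a * cos_series m \<mu> x + b * cos_series m \<nu> x = cos_series m (\<lambda>k. a * \<mu> k + b * \<nu> k) x"
  unfolding cos_series_def
  by (simp add: sum.distrib sum_distrib_left add_divide_distrib distrib_right mult.assoc)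

text \<open>Allows the constant produced by centring to be absorbed into a spectrum.\<close>

lemma cos_series_zero_frequency:
  "m > 0 \<Longrightarrow> cos_series m (\<lambda>k. if k = 0 then c else 0) x = c / real m"
proof -
  assume "m > 0"
  have "(\<Sum>k<m. (if k = 0 then c else 0) * cos (2 * pi * real k * x / real m)) = (\<Sum>k<m. if k = 0 then c else 0)"
    by (intro sum.cong) auto
  with \<open>m > 0\<close> show ?thesis by (simp add: cos_series_def)
qed

text \<open>Frequencies \<open>k\<close> and \<open>m - k\<close> contribute equally at integer points.\<close>

lemma cos_series_even:
  fixes z :: int
  assumes m: "m = 2 * h" "h > 0" and sym: "\<And>k. 0 < k \<Longrightarrow> k < m \<Longrightarrow> \<mu> (m - k) = \<mu> k"
  shows "cos_series m \<mu> (of_int z) = (\<mu> 0 + \<mu> h * cos (pi * of_int z)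
     + 2 * (\<Sum>k = 1..h - 1. \<mu> k * cos (2 * pi * real k * of_int z / real m))) / real m"
proof -
  define f where "f k = \<mu> k * cos (2 * pi * real k * of_int z / real m)" for k
  have fsym: "f (m - k) = f k" if "0 < k" "k < m" for k
  proof -
    have "2 * pi * real (m - k) * of_int z / real m
        = 2 * pi * of_int z - 2 * pi * real k * of_int z / real m"
      using that by (simp add: of_nat_diff field_simps)
    hence "cos (2 * pi * real (m - k) * of_int z / real m) = cos (2 * pi * real k * of_int z / real m)"
      by (simp add: cos_diff)
    with sym[OF that] show ?thesis by (simp add: f_def)
  qed
  have refl: "(\<Sum>k = h + 1..m - 1. f k) = (\<Sum>k = 1..h - 1. f k)"
    by (rule sum.reindex_bij_witness[where i = "\<lambda>k. m - k" and j = "\<lambda>k. m - k"])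
       (use m fsym in auto)
  \<comment> \<open>The frequencies 0 and \<open>h\<close> are their own partners modulo
    \<open>m\<close>; the others form two halves exchanged by the reflection.\<close>
  have "{..<m} = insert 0 (insert h ({1..h - 1} \<union> {h + 1..m - 1}))" using m by auto
  hence "(\<Sum>k<m. f k) = f 0 + f h + (\<Sum>k\<in>{1..h - 1} \<union> {h + 1..m - 1}. f k)" using m by simp
  also have "(\<Sum>k\<in>{1..h - 1} \<union> {h + 1..m - 1}. f k) = 2 * (\<Sum>k = 1..h - 1. f k)"
    by (subst sum.union_disjoint) (use refl in auto)
  finally show ?thesis unfolding cos_series_def f_def using m by simp
qed

section \<open>The factor of the centred distance matrix\<close>

lemma index_mult_mat_sum:
  assumes "M \<in> carrier_mat a b" "M' \<in> carrier_mat b c" "i < a" "j < c"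
  shows "(M * M') $$ (i, j) = (\<Sum>l<b. M $$ (i, l) * M' $$ (l, j))"
  using assms by (auto simp: scalar_prod_def lessThan_atLeast0 intro!: sum.cong)

lemma gear_index_cases:
  assumes "r < 2 * m + 1"
  obtains (hub) "r = 0" | (rim) i where "i < m" "r = Suc i" | (subdiv) i where "i < m" "r = Suc (m + i)"
proof -
  consider "r = 0" | "0 < r" "r \<le> m" | "m < r" by linarith
  thus thesis
  proof cases
    case 2
    thus thesis using rim[of "r - 1"] by auto
  next
    case 3
    thus thesis using subdiv[of "r - 1 - m"] assms by auto
  qed (rule hub)
qed

lemma sum_gear_index:
  fixes f :: "nat \<Rightarrow> real"
  shows "(\<Sum>r<2 * m + 1. f r) = f 0 + (\<Sum>i<m. f (Suc i)) + (\<Sum>i<m. f (Suc (m + i)))"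
proof -
  have "(\<Sum>r<2 * m + 1. f r) = f 0 + (\<Sum>r<m + m. f (Suc r))"
    using sum.lessThan_Suc_shift[of f "m + m"] by (simp add: mult_2 del: sum.lessThan_Suc)
  also have "(\<Sum>r<m + m. f (Suc r)) = (\<Sum>i<m. f (Suc i)) + (\<Sum>i<m. f (Suc (m + i)))"
    using sum.atLeastLessThan_concat[of 0 m "m + m" "\<lambda>r. f (Suc r)"]
      sum.shift_bounds_nat_ivl[of "\<lambda>r. f (Suc r)" 0 m m]
    by (simp add: lessThan_atLeast0 add.commute)
  finally show ?thesis by simp
qed

text \<open>Row \<open>0\<close> is the hub, rows \<open>1..m\<close> its neighbours, the last \<open>m\<close> rows the remaining vertices.
  \<open>a = 0\<close> gives \<open>G\<close>; since every column of \<open>G\<close> sums to 3, \<open>a = 3 / (2 m + 1)\<close> gives \<open>P G\<close>.\<close>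

definition gear_factor :: "nat \<Rightarrow> real \<Rightarrow> real mat" where
  "gear_factor m a = mat (2 * m + 1) m (\<lambda>(r, j).
     (if r = 0 then 0 else if r \<le> m then of_bool (j = r - 1)
      else of_bool (j = r - 1 - m) + of_bool (j = (r - m) mod m)) - a)"

lemma gear_factor_carrier: "gear_factor m a \<in> carrier_mat (2 * m + 1) m"
  by (simp add: gear_factor_def)

lemma gear_factor_index:
  assumes "j < m"
  shows "gear_factor m a $$ (0, j) = - a"
    and "i < m \<Longrightarrow> gear_factor m a $$ (Suc i, j) = of_bool (j = i) - a"
    and "i < m \<Longrightarrow> gear_factor m a $$ (Suc (m + i), j) = of_bool (j = i) + of_bool (j = Suc i mod m) - a"
  using assms by (simp_all add: gear_factor_def Suc_diff_le)

text \<open>A row of \<open>gear_factor m 0\<close> picks out no entry, one entry or two cyclically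
  adjacent entries of \<open>x\<close>; the shift by \<open>a\<close> only sees the total of
  \<open>x\<close>.\<close>

lemma sum_gear_factor_row:
  fixes x :: "nat \<Rightarrow> real"
  shows "(\<Sum>j<m. gear_factor m a $$ (0, j) * x j) = - a * (\<Sum>j<m. x j)"
    and "i < m \<Longrightarrow> (\<Sum>j<m. gear_factor m a $$ (Suc i, j) * x j) = x i - a * (\<Sum>j<m. x j)"
    and "i < m \<Longrightarrow> (\<Sum>j<m. gear_factor m a $$ (Suc (m + i), j) * x j)
           = x i + x (Suc i mod m) - a * (\<Sum>j<m. x j)"
proof -
  have del: "(\<Sum>j<m. of_bool (j = p) * x j) = x p" if "p < m" for p
    using that by (simp add: of_bool_def if_distrib[of "\<lambda>t. t * _"] cong: if_cong)
  show "(\<Sum>j<m. gear_factor m a $$ (0, j) * x j) = - a * (\<Sum>j<m. x j)"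
    by (simp add: gear_factor_index sum_distrib_left)
  show "(\<Sum>j<m. gear_factor m a $$ (Suc i, j) * x j) = x i - a * (\<Sum>j<m. x j)" if "i < m"
    using that by (simp add: gear_factor_index left_diff_distrib sum_subtractf del sum_distrib_left
        del: sum_of_bool_mult_eq)
  show "(\<Sum>j<m. gear_factor m a $$ (Suc (m + i), j) * x j)
           = x i + x (Suc i mod m) - a * (\<Sum>j<m. x j)" if "i < m"
    using that by (simp add: gear_factor_index left_diff_distrib distrib_right sum.distrib sum_subtractf del sum_distrib_left
        del: sum_of_bool_mult_eq)
qed

text \<open>Turns the cyclic successor in a row into the cyclic predecessor in a column. The
  predecessor is written with \<open>+ m\<close> so that \<open>j = 0\<close> is not caught by
  truncated subtraction.\<close>

lemma Suc_mod_eq_iff: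
  assumes "i < m" "j < m"
  shows "j = Suc i mod m \<longleftrightarrow> i = (j + m - 1) mod m"
proof (cases "Suc i = m")
  case True
  thus ?thesis using assms by (cases "j = 0") (auto simp: mod_if)
next
  case False
  thus ?thesis using assms by (cases "j = 0") (auto simp: mod_if)
qed

text \<open>Column \<open>j\<close> of \<open>gear_factor m 0\<close> meets one vertex next to the
  hub and two outer vertices, \<open>j\<close> and its cyclic predecessor.\<close>

lemma sum_gear_factor_col:
  fixes y :: "nat \<Rightarrow> real"
  assumes j: "j < m"
  shows "(\<Sum>r<2 * m + 1. gear_factor m a $$ (r, j) * y r)
     = y (Suc j) + y (Suc (m + j)) + y (Suc (m + (j + m - 1) mod m)) - a * (\<Sum>r<2 * m + 1. y r)"
proof -
  have del: "(\<Sum>i<m. of_bool (i = p) * x i) = x p" if "p < m" for p and x :: "nat \<Rightarrow> real"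
    using that by (simp add: of_bool_def if_distrib[of "\<lambda>t. t * _"] cong: if_cong)
  have p: "(j + m - 1) mod m < m" using j by simp
  have 1: "(\<Sum>i<m. gear_factor m a $$ (Suc i, j) * y (Suc i)) = y (Suc j) - a * (\<Sum>i<m. y (Suc i))"
  proof -
    have "(\<Sum>i<m. gear_factor m a $$ (Suc i, j) * y (Suc i))
       = (\<Sum>i<m. of_bool (i = j) * y (Suc i) - a * y (Suc i))"
      using j by (intro sum.cong) (auto simp: gear_factor_index algebra_simps)
    thus ?thesis using del[OF j, of "\<lambda>i. y (Suc i)"] by (simp only: sum_subtractf sum_distrib_left)
  qed
  have 2: "(\<Sum>i<m. gear_factor m a $$ (Suc (m + i), j) * y (Suc (m + i)))
     = y (Suc (m + j)) + y (Suc (m + (j + m - 1) mod m)) - a * (\<Sum>i<m. y (Suc (m + i)))"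
  proof -
    have "(\<Sum>i<m. gear_factor m a $$ (Suc (m + i), j) * y (Suc (m + i)))
       = (\<Sum>i<m. of_bool (i = j) * y (Suc (m + i)) + of_bool (i = (j + m - 1) mod m) * y (Suc (m + i))
            - a * y (Suc (m + i)))"
      using j by (intro sum.cong) (auto simp: gear_factor_index Suc_mod_eq_iff left_diff_distrib distrib_right)
    thus ?thesis using del[OF j, of "\<lambda>i. y (Suc (m + i))"] del[OF p, of "\<lambda>i. y (Suc (m + i))"]
      by (simp only: sum_subtractf sum.distrib sum_distrib_left)
  qed
  show ?thesis unfolding sum_gear_index 1 2 using j by (simp add: gear_factor_index algebra_simps)
qed

section \<open>The Gram matrix acting on circulants with a cosine spectrum\<close>

definition cos_circulant :: "nat \<Rightarrow> (nat \<Rightarrow> real) \<Rightarrow> real mat" where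
  "cos_circulant m \<mu> = mat m m (\<lambda>(i, j). cos_series m \<mu> (real i - real j))"

lemma cos_circulant_carrier: "cos_circulant m \<mu> \<in> carrier_mat m m"
  by (simp add: cos_circulant_def)

lemma cos_circulant_sym: "transpose_mat (cos_circulant m \<mu>) = cos_circulant m \<mu>"
  by (rule eq_matI) (auto simp: cos_circulant_def cos_series_swap)

lemma cos_circulant_one: "cos_circulant m (\<lambda>_. 1) = 1\<^sub>m m"
  by (rule eq_matI) (auto simp: cos_circulant_def cos_series_kronecker)

text \<open>Periodicity hides the wrap-around, so the last index needs no separate treatment
  afterwards.\<close>

lemma cos_series_Suc_mod:
  assumes "i < m"
  shows "cos_series m \<mu> (real (Suc i mod m) - x) = cos_series m \<mu> (real i - x + 1)"
proof (cases "Suc i = m")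
  case True
  hence "real i - x + 1 = (0 - x) + real m" by auto
  with True cos_series_periodic[of m \<mu> "0 - x"] assms show ?thesis by (simp only: mod_self of_nat_0)
next
  case False
  with assms show ?thesis by (simp add: algebra_simps)
qed

lemma cos_series_pred_mod:
  assumes "i < m"
  shows "cos_series m \<mu> (real ((i + m - 1) mod m) - x) = cos_series m \<mu> (real i - x - 1)"
proof -
  have "i = Suc ((i + m - 1) mod m) mod m" using Suc_mod_eq_iff[of "(i + m - 1) mod m" m i] assms by simp
  with cos_series_Suc_mod[of "(i + m - 1) mod m" m \<mu> "x + 1"] assms show ?thesis by (simp add: algebra_simps)
qed

text \<open>The Gram matrix of the uncentred factor is 3 I plus the adjacency matrix of the cycle.
  Its columns sum to 3, so centring subtracts 9 / (2 m + 1) times J, whose only nonzero eigenvalue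
  is \<open>m\<close>, at frequency 0.\<close>

definition gear_eig :: "nat \<Rightarrow> nat \<Rightarrow> real" where
  "gear_eig m k = 3 + 2 * cos (2 * pi * real k / real m)
     - (if k = 0 then 9 * real m / (2 * real m + 1) else 0)"

lemma gear_eig_pos:
  shows "gear_eig m k > 0"
proof (cases "k = 0")
  case True
  \<comment> \<open>The value here is (m + 5) / (2 m + 1).\<close>
  thus ?thesis by (simp add: gear_eig_def field_simps)
next
  case False
  have "cos (2 * pi * real k / real m) \<ge> -1" by simp
  hence "3 + 2 * cos (2 * pi * real k / real m) > 0" by linarith
  thus ?thesis using False by (simp add: gear_eig_def)
qed

abbreviation gear_centred :: "nat \<Rightarrow> real mat" where
  "gear_centred m \<equiv> gear_factor m (3 / (2 * real m + 1))"

text \<open>The Gram matrix is itself a circulant, so it multiplies spectra pointwise. Formulating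
  this as an action on an arbitrary spectrum makes it iterable: two applications give the square of
  the Gram matrix.\<close>

lemma gear_gram_cos_circulant:
  assumes m: "m > 0"
  shows "transpose_mat (gear_centred m) * (gear_centred m * cos_circulant m \<mu>)
    = cos_circulant m (\<lambda>k. gear_eig m k * \<mu> k)"
proof (rule eq_matI)
  fix j l
  assume "j < dim_row (cos_circulant m (\<lambda>k. gear_eig m k * \<mu> k))"
    and "l < dim_col (cos_circulant m (\<lambda>k. gear_eig m k * \<mu> k))"
  hence j: "j < m" and l: "l < m" by (simp_all add: cos_circulant_def)
  define a where "a = 3 / (2 * real m + 1)"
  define F where "F = gear_factor m a"
  define q where "q i = cos_series m \<mu> (real i - real l)" for i
  define Y where "Y r = (F * cos_circulant m \<mu>) $$ (r, l)" for r
  have sq: "(\<Sum>i<m. q i) = \<mu> 0" unfolding q_def by (rule sum_cos_series[OF m])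
  have F: "F \<in> carrier_mat (2 * m + 1) m" unfolding F_def by (rule gear_factor_carrier)
  have Y: "Y r = (\<Sum>i<m. F $$ (r, i) * q i)" if "r < 2 * m + 1" for r
    unfolding Y_def q_def index_mult_mat_sum[OF F cos_circulant_carrier that l]
    using l by (simp add: cos_circulant_def)
  have Y0: "Y 0 = - a * \<mu> 0" using Y[of 0] sum_gear_factor_row(1)[of m a q] sq by (simp add: F_def)
  have Y1: "Y (Suc i) = q i - a * \<mu> 0" if "i < m" for i
    using Y[of "Suc i"] sum_gear_factor_row(2)[of i m a q] sq that by (simp add: F_def)
  have Y2: "Y (Suc (m + i)) = q i + cos_series m \<mu> (real i - real l + 1) - a * \<mu> 0" if "i < m" for i
    using Y[of "Suc (m + i)"] sum_gear_factor_row(3)[of i m a q] sq that cos_series_Suc_mod[of i m \<mu> "real l"]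
    by (simp add: F_def q_def)
  have "(\<Sum>i<m. cos_series m \<mu> (real i - real l + 1)) = \<mu> 0"
    using sum_cos_series[OF m, of \<mu> "real l - 1"] by (simp add: algebra_simps)
  \<comment> \<open>The choice of \<open>a\<close> makes every column of \<open>F\<close> sum to 0,
    hence also every column of its product with the circulant. The shift in the transposed factor
    then contributes nothing.\<close>
  hence sY: "(\<Sum>r<2 * m + 1. Y r) = 3 * \<mu> 0 - (2 * real m + 1) * a * \<mu> 0"
    unfolding sum_gear_index using sq by (simp add: Y0 Y1 Y2 sum.distrib sum_subtractf) (simp add: algebra_simps)
  also have "\<dots> = 0"
  proof -
    have "x * (3 / x) = 3" if "x > 0" for x :: real using that by simp
    from this[of "2 * real m + 1"] have "(2 * real m + 1) * a = 3" by (simp only: a_def)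
    thus ?thesis by simp
  qed
  finally have sY: "(\<Sum>r<2 * m + 1. Y r) = 0" .
  have p: "(j + m - 1) mod m < m" using m by simp
  have "(transpose_mat F * (F * cos_circulant m \<mu>)) $$ (j, l) = (\<Sum>r<2 * m + 1. F $$ (r, j) * Y r)"
    unfolding Y_def using F j l cos_circulant_carrier[of m \<mu>]
    by (subst index_mult_mat_sum[of _ m "2 * m + 1" _ m]) auto
  also have "\<dots> = Y (Suc j) + Y (Suc (m + j)) + Y (Suc (m + (j + m - 1) mod m))"
    unfolding F_def sum_gear_factor_col[OF j] sY by simp
  also have "\<dots> = 3 * q j + (cos_series m \<mu> (real j - real l + 1) + cos_series m \<mu> (real j - real l - 1)) - 3 * a * \<mu> 0"
    unfolding Y1[OF j] Y2[OF j] Y2[OF p]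
    using cos_series_pred_mod[OF j, of \<mu> "real l"] cos_series_pred_mod[OF j, of \<mu> "real l - 1"]
    by (simp add: q_def algebra_simps)
  \<comment> \<open>The constant is rewritten as a series supported at frequency 0. Its coefficient
    3 a m is the correction 9 m / (2 m + 1) in \<open>gear_eig\<close>.\<close>
  also have "\<dots> = 1 * cos_series m (\<lambda>k. 3 * \<mu> k + 1 * (\<mu> k * (2 * cos (2 * pi * real k / real m)))) (real j - real l)
     + (-1) * cos_series m (\<lambda>k. if k = 0 then 3 * a * \<mu> 0 * real m else 0) (real j - real l)"
    unfolding cos_series_neighbours cos_series_lincomb[symmetric] cos_series_zero_frequency[OF m]
    using m by (simp add: q_def)
  also have "\<dots> = cos_series m (\<lambda>k. gear_eig m k * \<mu> k) (real j - real l)"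
    unfolding cos_series_lincomb
    by (rule arg_cong[of _ _ "\<lambda>f. cos_series m f _"]) (auto simp: gear_eig_def a_def algebra_simps)
  finally show "(transpose_mat (gear_centred m) * (gear_centred m * cos_circulant m \<mu>)) $$ (j, l)
      = cos_circulant m (\<lambda>k. gear_eig m k * \<mu> k) $$ (j, l)"
    using j l by (simp add: F_def a_def cos_circulant_def)
qed (simp_all add: cos_circulant_def gear_factor_def)

lemma is_mp_inverse_gear:
  assumes "m > 0"
  shows "is_mp_inverse (gear_centred m * transpose_mat (gear_centred m))
    (gear_centred m * cos_circulant m (\<lambda>k. 1 / (gear_eig m k)\<^sup>2) * transpose_mat (gear_centred m))"
proof (rule is_mp_inverse_gram[OF gear_factor_carrier cos_circulant_carrier cos_circulant_sym])
  have "gear_eig m k \<noteq> 0" for k using gear_eig_pos[of m k] by simp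
  hence "(\<lambda>k. gear_eig m k * (gear_eig m k * (1 / (gear_eig m k)\<^sup>2))) = (\<lambda>_. 1)"
    by (auto simp: power2_eq_square)
  thus "transpose_mat (gear_centred m) * (gear_centred m * (transpose_mat (gear_centred m) *
      (gear_centred m * cos_circulant m (\<lambda>k. 1 / (gear_eig m k)\<^sup>2)))) = 1\<^sub>m m"
    unfolding gear_gram_cos_circulant[OF assms] by (simp add: cos_circulant_one)
qed

section \<open>The centred distance matrix\<close>

text \<open>The index patterns are those of \<open>gear_index_cases\<close>, so a comparison of
  block matrices becomes nine scalar comparisons.\<close>

lemma nine_block_mat_index:
  assumes "M11 \<in> carrier_mat 1 1" "M12 \<in> carrier_mat 1 m" "M13 \<in> carrier_mat 1 m"
    and "M21 \<in> carrier_mat m 1" "M22 \<in> carrier_mat m m" "M23 \<in> carrier_mat m m"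
    and "M31 \<in> carrier_mat m 1" "M32 \<in> carrier_mat m m" "M33 \<in> carrier_mat m m"
  defines "M \<equiv> nine_block_mat M11 M12 M13 M21 M22 M23 M31 M32 M33"
  shows "M \<in> carrier_mat (2 * m + 1) (2 * m + 1)"
    and "M $$ (0, 0) = M11 $$ (0, 0)"
    and "j < m \<Longrightarrow> M $$ (0, Suc j) = M12 $$ (0, j)"
    and "j < m \<Longrightarrow> M $$ (0, Suc (m + j)) = M13 $$ (0, j)"
    and "i < m \<Longrightarrow> M $$ (Suc i, 0) = M21 $$ (i, 0)"
    and "i < m \<Longrightarrow> j < m \<Longrightarrow> M $$ (Suc i, Suc j) = M22 $$ (i, j)"
    and "i < m \<Longrightarrow> j < m \<Longrightarrow> M $$ (Suc i, Suc (m + j)) = M23 $$ (i, j)"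
    and "i < m \<Longrightarrow> M $$ (Suc (m + i), 0) = M31 $$ (i, 0)"
    and "i < m \<Longrightarrow> j < m \<Longrightarrow> M $$ (Suc (m + i), Suc j) = M32 $$ (i, j)"
    and "i < m \<Longrightarrow> j < m \<Longrightarrow> M $$ (Suc (m + i), Suc (m + j)) = M33 $$ (i, j)"
proof -
  note dims = assms(1-9)[THEN carrier_matD(1)] assms(1-9)[THEN carrier_matD(2)]
  show "M \<in> carrier_mat (2 * m + 1) (2 * m + 1)"
    unfolding M_def nine_block_mat_def by (rule carrier_matI) (simp_all only: index_mat_four_block dims)
  show "M $$ (0, 0) = M11 $$ (0, 0)"
    "j < m \<Longrightarrow> M $$ (0, Suc j) = M12 $$ (0, j)"
    "j < m \<Longrightarrow> M $$ (0, Suc (m + j)) = M13 $$ (0, j)"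
    "i < m \<Longrightarrow> M $$ (Suc i, 0) = M21 $$ (i, 0)"
    "i < m \<Longrightarrow> j < m \<Longrightarrow> M $$ (Suc i, Suc j) = M22 $$ (i, j)"
    "i < m \<Longrightarrow> j < m \<Longrightarrow> M $$ (Suc i, Suc (m + j)) = M23 $$ (i, j)"
    "i < m \<Longrightarrow> M $$ (Suc (m + i), 0) = M31 $$ (i, 0)"
    "i < m \<Longrightarrow> j < m \<Longrightarrow> M $$ (Suc (m + i), Suc j) = M32 $$ (i, j)"
    "i < m \<Longrightarrow> j < m \<Longrightarrow> M $$ (Suc (m + i), Suc (m + j)) = M33 $$ (i, j)"
    unfolding M_def nine_block_mat_def
    by (simp_all add: dims)
qed

text \<open>Translates the exceptional offsets of the circulants S and T into equality and cyclic
  adjacency. For offset 1 the bound on \<open>p\<close> matters: with \<open>p = 1\<close> the right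
  side holds while the offset is 0.\<close>

lemma circ_offset_iff:
  fixes i j p :: nat
  assumes "i < p" "j < p"
  shows "(j + p - i) mod p = 0 \<longleftrightarrow> i = j"
    and "(j + p - i) mod p = p - 1 \<longleftrightarrow> i = Suc j mod p"
    and "p \<ge> 2 \<Longrightarrow> (j + p - i) mod p = 1 \<longleftrightarrow> j = Suc i mod p"
proof -
  have o: "(j + p - i) mod p = (if i \<le> j then j - i else j + p - i)"
    using assms by (auto simp: mod_if)
  have s: "Suc k mod p = (if Suc k = p then 0 else Suc k)" if "k < p" for k
    using that by auto
  show "(j + p - i) mod p = 0 \<longleftrightarrow> i = j" unfolding o using assms by auto
  show "(j + p - i) mod p = p - 1 \<longleftrightarrow> i = Suc j mod p"
    unfolding o s[OF assms(2)] using assms by auto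
  show "(j + p - i) mod p = 1 \<longleftrightarrow> j = Suc i mod p" if "p \<ge> 2"
    unfolding o s[OF assms(1)] using assms that by auto
qed

lemma circ_carrier: "length a = p \<Longrightarrow> circ a \<in> carrier_mat p p"
  by (auto simp: circ_def Let_def)

text \<open>This form exhibits S as 3 J minus twice the identity plus a cyclic shift, where 3 = 1 +
  2 is the sum of the two distances to the hub.\<close>

lemma S_mat_index:
  assumes m: "m \<ge> 2" and i: "i < m" and j: "j < m"
  shows "S_mat (Suc m) $$ (i, j) = 3 - 2 * (of_bool (i = j) + of_bool (i = Suc j mod m))"
proof -
  let ?a = "[1::real] @ replicate (Suc m - 3) 3 @ [1]" and ?d = "(j + m - i) mod m"
  have len: "length ?a = m" using m by simp
  have nth: "?a ! d = 3 - 2 * (of_bool (d = 0) + of_bool (d = m - 1))" if "d < m" for d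
    using that m by (auto simp: nth_append nth_Cons')
  have "S_mat (Suc m) $$ (i, j) = ?a ! ?d"
    unfolding S_mat_def using circ_index[of i ?a j, unfolded len, OF i j] .
  also have "\<dots> = 3 - 2 * (of_bool (?d = 0) + of_bool (?d = m - 1))"
    by (rule nth) (use i in simp)
  finally show ?thesis unfolding circ_offset_iff[OF i j] .
qed

text \<open>As for S, with 4 = 2 + 2. The bound on \<open>m\<close> keeps the offsets 0, 1 and
  \<open>m - 1\<close> distinct.\<close>

lemma T_mat_index:
  assumes m: "m \<ge> 3" and i: "i < m" and j: "j < m"
  shows "T_mat (Suc m) $$ (i, j)
    = 4 - 4 * of_bool (i = j) - 2 * of_bool (i = Suc j mod m) - 2 * of_bool (j = Suc i mod m)"
proof -
  let ?a = "[0::real, 2] @ replicate (Suc m - 4) 4 @ [2]" and ?d = "(j + m - i) mod m"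
  have len: "length ?a = m" using m by simp
  have nth: "?a ! d = 4 - 4 * of_bool (d = 0) - 2 * of_bool (d = m - 1) - 2 * of_bool (d = 1)"
    if "d < m" for d
    using that m by (auto simp: nth_append nth_Cons')
  have m2: "m \<ge> 2" using m by simp
  have "T_mat (Suc m) $$ (i, j) = ?a ! ?d"
    unfolding T_mat_def using circ_index[of i ?a j, unfolded len, OF i j] .
  also have "\<dots> = 4 - 4 * of_bool (?d = 0) - 2 * of_bool (?d = m - 1) - 2 * of_bool (?d = 1)"
    by (rule nth) (use i in simp)
  finally show ?thesis unfolding circ_offset_iff(1,2)[OF i j] circ_offset_iff(3)[OF i j m2] .
qed

lemma S_mat_carrier: "m \<ge> 2 \<Longrightarrow> S_mat (Suc m) \<in> carrier_mat m m"
  unfolding S_mat_def by (rule circ_carrier) simp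

lemma T_mat_carrier: "m \<ge> 3 \<Longrightarrow> T_mat (Suc m) \<in> carrier_mat m m"
  unfolding T_mat_def by (rule circ_carrier) simp

definition hub_dist :: "nat \<Rightarrow> nat \<Rightarrow> real" where
  "hub_dist m r = (if r = 0 then 0 else if r \<le> m then 1 else 2)"

lemma Suc_mod_inj:
  assumes "i < m" "j < m"
  shows "Suc i mod m = Suc j mod m \<longleftrightarrow> i = j"
  using assms by (auto simp: mod_if split: if_splits)

lemma E_mat_carrier: 
  assumes "m \<ge> 3"
  shows "E_mat (Suc m) \<in> carrier_mat (2 * m + 1) (2 * m + 1)"
  unfolding E_mat_def
  by (rule nine_block_mat_index(1)) (use assms S_mat_carrier T_mat_carrier in \<open>auto simp: ones_mat_def\<close>)

text \<open>Half of d(0, r) + d(0, t) - d(r, t) is the Gromov product at the hub, and in the gear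
  graph it is the inner product of rows \<open>r\<close> and \<open>t\<close> of
  \<open>gear_factor m 0\<close>. The terms in \<open>hub_dist\<close> are the part of E that
  centring removes.\<close>

lemma E_mat_index:
  assumes m: "m \<ge> 3" and r: "r < 2 * m + 1" and t: "t < 2 * m + 1"
  shows "E_mat (Suc m) $$ (r, t)
    = hub_dist m r + hub_dist m t - 2 * (\<Sum>l<m. gear_factor m 0 $$ (r, l) * gear_factor m 0 $$ (t, l))"
proof -
  have m0: "i < m \<Longrightarrow> Suc i mod m < m" for i using m by simp
  have m2: "m \<ge> 2" using m by simp
  note S = S_mat_carrier[OF m2] and T = T_mat_carrier[OF m]
  have eq: "E_mat (Suc m) = nine_block_mat (0\<^sub>m 1 1) (ones_mat 1 m) (2 \<cdot>\<^sub>m ones_mat 1 m)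
      (ones_mat m 1) (2 \<cdot>\<^sub>m (J_mat m - 1\<^sub>m m)) (S_mat (Suc m))
      (2 \<cdot>\<^sub>m ones_mat m 1) (transpose_mat (S_mat (Suc m))) (T_mat (Suc m))"
    by (simp add: E_mat_def)
  have blocks: "ones_mat a b \<in> carrier_mat a b" "J_mat m - 1\<^sub>m m \<in> carrier_mat m m" for a b
    by (auto intro!: carrier_matI simp: ones_mat_def)
  note E = nine_block_mat_index(2-10)[OF zero_carrier_mat blocks(1) smult_carrier_mat[OF blocks(1), of 2]
      blocks(1) smult_carrier_mat[OF blocks(2), of 2] S
      smult_carrier_mat[OF blocks(1), of 2] transpose_carrier_mat[THEN iffD2, OF S] T, folded eq]
  note E' = E(1) E(2-9)[unfolded ones_mat_def]
  let ?G = "\<lambda>r l. gear_factor m 0 $$ (r, l)"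
  note row = sum_gear_factor_row[where m = m and a = 0 and x = "?G t"]
  from r show ?thesis
  proof (cases rule: gear_index_cases)
    case hub
    have R: "(\<Sum>l<m. ?G r l * ?G t l) = 0" using row(1) hub by simp
    from t show ?thesis unfolding R
      by (cases rule: gear_index_cases) (simp_all add: hub E' hub_dist_def)
  next
    case (rim i)
    have R: "(\<Sum>l<m. ?G r l * ?G t l) = ?G t i" using row(2) rim by simp
    from t show ?thesis unfolding R
      by (cases rule: gear_index_cases)
        (use rim in \<open>simp_all add: E' S_mat_index[OF m2] hub_dist_def gear_factor_index\<close>)
  next
    case (subdiv i)
    have R: "(\<Sum>l<m. ?G r l * ?G t l) = ?G t i + ?G t (Suc i mod m)" using row(3) subdiv by simp
    from t show ?thesis unfolding R
    proof (cases rule: gear_index_cases)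
      case (rim j)
      have "(transpose_mat (S_mat (Suc m))) $$ (i, j) = S_mat (Suc m) $$ (j, i)"
        using S rim subdiv by (intro index_transpose_mat(1)) auto
      thus "E_mat (Suc m) $$ (r, t) = hub_dist m r + hub_dist m t - 2 * (?G t i + ?G t (Suc i mod m))"
        using rim \<open>i < m\<close> \<open>r = Suc (m + i)\<close>
        by (simp add: E'(8) S_mat_index[OF m2] hub_dist_def gear_factor_index m0 eq_commute[of _ j])
    next
      \<comment> \<open>On the diagonal both unit entries of the row match, which accounts for the
        coefficient 4 in \<open>T_mat_index\<close>; \<open>Suc_mod_inj\<close> turns the second
        match into \<open>i = j\<close>.\<close>
      case (subdiv j)
      thus "E_mat (Suc m) $$ (r, t) = hub_dist m r + hub_dist m t - 2 * (?G t i + ?G t (Suc i mod m))"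
        using \<open>i < m\<close> \<open>r = Suc (m + i)\<close>
        by (simp add: E'(9) T_mat_index[OF m] hub_dist_def gear_factor_index m0 Suc_mod_inj eq_commute[of _ j])
    qed (use subdiv in \<open>simp add: E' hub_dist_def gear_factor_index m0\<close>)
  qed
qed

section \<open>Centring on both sides\<close>

lemma centring_mult:
  assumes M: "M \<in> carrier_mat N c" and "i < N" "j < c"
  shows "((1\<^sub>m N - a \<cdot>\<^sub>m J_mat N) * M) $$ (i, j) = M $$ (i, j) - a * (\<Sum>l<N. M $$ (l, j))"
proof -
  have "((1\<^sub>m N - a \<cdot>\<^sub>m J_mat N) * M) $$ (i, j) = (\<Sum>l<N. (of_bool (i = l) - a) * M $$ (l, j))"
    using assms by (subst index_mult_mat_sum[of _ N N _ c]) (auto simp: ones_mat_def intro!: sum.cong)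
  also have "\<dots> = (\<Sum>l<N. if l = i then M $$ (l, j) else 0) - a * (\<Sum>l<N. M $$ (l, j))"
    unfolding sum_distrib_left sum_subtractf[symmetric]
    by (intro sum.cong) (auto simp: left_diff_distrib)
  finally show ?thesis using assms by simp
qed

lemma mult_centring:
  assumes M: "M \<in> carrier_mat c N" and "i < c" "j < N"
  shows "(M * (1\<^sub>m N - a \<cdot>\<^sub>m J_mat N)) $$ (i, j) = M $$ (i, j) - a * (\<Sum>l<N. M $$ (i, l))"
proof -
  have "(M * (1\<^sub>m N - a \<cdot>\<^sub>m J_mat N)) $$ (i, j) = (\<Sum>l<N. M $$ (i, l) * (of_bool (l = j) - a))"
    using assms by (subst index_mult_mat_sum[of _ c N _ N]) (auto simp: ones_mat_def intro!: sum.cong)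
  also have "\<dots> = (\<Sum>l<N. if l = j then M $$ (i, l) else 0) - a * (\<Sum>l<N. M $$ (i, l))"
    unfolding sum_distrib_left sum_subtractf[symmetric]
    by (intro sum.cong) (auto simp: right_diff_distrib)
  finally show ?thesis using assms by simp
qed

lemma gear_factor_shift:
  "r < 2 * m + 1 \<Longrightarrow> l < m \<Longrightarrow> gear_factor m a $$ (r, l) = gear_factor m 0 $$ (r, l) - a"
  by (simp add: gear_factor_def)

lemma U_eq_gear_gram:
  fixes P :: "real mat"
  assumes m: "m \<ge> 3" and P: "P = 1\<^sub>m (2 * m + 1) - (1 / real (2 * m + 1)) \<cdot>\<^sub>m J_mat (2 * m + 1)"
  shows "(- 1 / 2) \<cdot>\<^sub>m (P * E_mat (Suc m) * P) = gear_centred m * transpose_mat (gear_centred m)"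
proof (rule eq_matI)
  define N where "N = 2 * m + 1"
  define G where "G r l = gear_factor m 0 $$ (r, l)" for r l
  define F where "F = gear_centred m"
  define u where "u = hub_dist m"
  have N0: "real N > 0" unfolding N_def by simp
  have F: "F \<in> carrier_mat N m" unfolding F_def N_def by (rule gear_factor_carrier)
  have FG: "F $$ (r, l) = G r l - 3 / real N" if "r < N" "l < m" for r l
    using gear_factor_shift[of r m l "3 / (2 * real m + 1)"] that by (simp add: F_def G_def N_def)
  have Gsum: "(\<Sum>r<N. G r l) = 3" if "l < m" for l
    using sum_gear_factor_col[OF that, of 0 "\<lambda>_. 1"] by (simp add: G_def N_def)
  have E: "E_mat (Suc m) \<in> carrier_mat N N" unfolding N_def by (rule E_mat_carrier[OF m])
  have Pc: "P \<in> carrier_mat N N" unfolding P N_def by (rule carrier_matI) (simp_all add: ones_mat_def)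
  \<comment> \<open>Left centring removes the summand \<open>u t\<close> and replaces G by
    \<open>F\<close> in the first factor. What remains of \<open>u\<close> is constant along row
    \<open>r\<close>, so right centring removes it too.\<close>
  have PE: "(P * E_mat (Suc m)) $$ (r, t) = u r - (\<Sum>s<N. u s) / real N - 2 * (\<Sum>l<m. F $$ (r, l) * G t l)"
    if r: "r < N" and t: "t < N" for r t
  proof -
    have Ert: "E_mat (Suc m) $$ (s, t) = u s + u t - 2 * (\<Sum>l<m. G s l * G t l)" if "s < N" for s
      using E_mat_index[OF m, of s t] that t by (simp add: N_def G_def u_def)
    have "(\<Sum>s<N. \<Sum>l<m. G s l * G t l) = (\<Sum>l<m. (\<Sum>s<N. G s l) * G t l)"
      by (subst sum.swap) (simp add: sum_distrib_right)
    also have "\<dots> = 3 * (\<Sum>l<m. G t l)" by (simp add: Gsum sum_distrib_left)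
    finally have GG: "(\<Sum>s<N. \<Sum>l<m. G s l * G t l) = 3 * (\<Sum>l<m. G t l)" .
    have "(\<Sum>s<N. E_mat (Suc m) $$ (s, t)) = (\<Sum>s<N. u s) + real N * u t - 6 * (\<Sum>l<m. G t l)"
      by (simp add: Ert sum.distrib sum_subtractf sum_distrib_left[symmetric] GG)
    moreover have "(\<Sum>l<m. F $$ (r, l) * G t l) = (\<Sum>l<m. G r l * G t l) - 3 / real N * (\<Sum>l<m. G t l)"
      using r by (simp add: FG left_diff_distrib sum_subtractf sum_distrib_left)
    moreover have "(P * E_mat (Suc m)) $$ (r, t)
        = E_mat (Suc m) $$ (r, t) - 1 / real N * (\<Sum>s<N. E_mat (Suc m) $$ (s, t))"
      unfolding P N_def[symmetric] by (rule centring_mult[OF E r t])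
    ultimately show ?thesis using N0 Ert[OF r] by (simp add: field_simps)
  qed
  have PEc: "P * E_mat (Suc m) \<in> carrier_mat N N" using Pc E by simp
  fix r t
  assume "r < dim_row (gear_centred m * transpose_mat (gear_centred m))"
    and "t < dim_col (gear_centred m * transpose_mat (gear_centred m))"
  hence r: "r < N" and t: "t < N" by (simp_all add: gear_factor_def N_def)
  have "(\<Sum>t<N. \<Sum>l<m. F $$ (r, l) * G t l) = (\<Sum>l<m. F $$ (r, l) * (\<Sum>t<N. G t l))"
    by (subst sum.swap) (simp add: sum_distrib_left)
  also have "\<dots> = 3 * (\<Sum>l<m. F $$ (r, l))" by (simp add: Gsum sum_distrib_left mult.commute)
  finally have FG3: "(\<Sum>t<N. \<Sum>l<m. F $$ (r, l) * G t l) = 3 * (\<Sum>l<m. F $$ (r, l))" .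
  have "(P * E_mat (Suc m) * P) $$ (r, t)
      = (P * E_mat (Suc m)) $$ (r, t) - 1 / real N * (\<Sum>s<N. (P * E_mat (Suc m)) $$ (r, s))"
    using mult_centring[OF PEc r t, of "1 / real N"] unfolding P N_def[symmetric] .
  also have "(\<Sum>s<N. (P * E_mat (Suc m)) $$ (r, s))
      = real N * (u r - (\<Sum>s<N. u s) / real N) - 6 * (\<Sum>l<m. F $$ (r, l))"
    using r by (simp add: PE sum_subtractf sum_distrib_left[symmetric] FG3 right_diff_distrib)
  finally have "(P * E_mat (Suc m) * P) $$ (r, t)
      = - 2 * ((\<Sum>l<m. F $$ (r, l) * G t l) - 3 / real N * (\<Sum>l<m. F $$ (r, l)))"
    using N0 unfolding PE[OF r t] by (simp add: right_diff_distrib)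
  also have "(\<Sum>l<m. F $$ (r, l) * G t l) - 3 / real N * (\<Sum>l<m. F $$ (r, l)) = (\<Sum>l<m. F $$ (r, l) * F $$ (t, l))"
    using t by (simp add: FG[of t] right_diff_distrib sum_subtractf sum_distrib_left mult_ac)
  also have "\<dots> = (F * transpose_mat F) $$ (r, t)"
    using F r t by (subst index_mult_mat_sum[of _ N m _ N]) auto
  finally show "((- 1 / 2) \<cdot>\<^sub>m (P * E_mat (Suc m) * P)) $$ (r, t) = (gear_centred m * transpose_mat (gear_centred m)) $$ (r, t)"
    using r t Pc PEc by (simp add: F_def)
qed (simp_all add: P gear_factor_def ones_mat_def)

section \<open>The entries of the inverse\<close>

text \<open>The shift by \<open>a\<close> meets the circulant only through its row sum
  \<open>\<mu> 0\<close>. Two shifts give the quadratic term of \<open>c\<close>, and the mixed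
  terms give \<open>d * a * \<mu> 0\<close>, where \<open>d\<close> is the sum of rows
  \<open>r\<close> and \<open>t\<close> of \<open>gear_factor m 0\<close>: 0 for the hub, 1 for its
  neighbours, 2 for the outer vertices.\<close>

lemma gear_factor_sandwich:
  fixes \<mu> :: "nat \<Rightarrow> real" and a :: real
  assumes m: "m > 0"
  defines "X \<equiv> gear_factor m a * cos_circulant m \<mu> * transpose_mat (gear_factor m a)"
    and "q \<equiv> cos_series m \<mu>"
    and "c \<equiv> (\<lambda>d. a\<^sup>2 * real m * \<mu> 0 - d * a * \<mu> 0)"
  shows "X $$ (0, 0) = c 0"
    and "j < m \<Longrightarrow> X $$ (0, Suc j) = c 1"
    and "j < m \<Longrightarrow> X $$ (0, Suc (m + j)) = c 2"
    and "i < m \<Longrightarrow> X $$ (Suc i, 0) = c 1"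
    and "i < m \<Longrightarrow> j < m \<Longrightarrow> X $$ (Suc i, Suc j) = q (real i - real j) + c 2"
    and "i < m \<Longrightarrow> j < m \<Longrightarrow> X $$ (Suc i, Suc (m + j))
           = q (real i - real j) + q (real i - real j - 1) + c 3"
    and "i < m \<Longrightarrow> X $$ (Suc (m + i), 0) = c 2"
    and "i < m \<Longrightarrow> j < m \<Longrightarrow> X $$ (Suc (m + i), Suc j)
           = q (real i - real j) + q (real i - real j + 1) + c 3"
    and "i < m \<Longrightarrow> j < m \<Longrightarrow> X $$ (Suc (m + i), Suc (m + j))
           = 2 * q (real i - real j) + (q (real i - real j + 1) + q (real i - real j - 1)) + c 4"
proof -
  define F where "F = gear_factor m a"
  define Y where "Y r l = (F * cos_circulant m \<mu>) $$ (r, l)" for r l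
  have F: "F \<in> carrier_mat (2 * m + 1) m" unfolding F_def by (rule gear_factor_carrier)
  have Y: "Y r l = (\<Sum>i<m. F $$ (r, i) * q (real i - real l))" if "r < 2 * m + 1" "l < m" for r l
    unfolding Y_def q_def index_mult_mat_sum[OF F cos_circulant_carrier that]
    using that by (simp add: cos_circulant_def)
  have sq: "(\<Sum>i<m. q (real i - x)) = \<mu> 0" for x unfolding q_def by (rule sum_cos_series[OF m])
  have sq1: "(\<Sum>i<m. q (x - real i)) = \<mu> 0" for x
    using sq[of x] unfolding q_def by (subst cos_series_swap)
  have q_next: "q (x - real (Suc j mod m)) = q (x - real j - 1)" if "j < m" for x j
    using cos_series_Suc_mod[OF that, of \<mu> x] cos_series_minus[of m \<mu> "real j - x + 1"]
    unfolding q_def by (subst cos_series_swap) (simp add: algebra_simps)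
  have Y0: "Y 0 l = - a * \<mu> 0" if "l < m" for l
    using Y[of 0 l] sum_gear_factor_row(1)[of m a "\<lambda>i. q (real i - real l)"] sq that by (simp add: F_def)
  have Y1: "Y (Suc i) l = q (real i - real l) - a * \<mu> 0" if "i < m" "l < m" for i l
    using Y[of "Suc i" l] sum_gear_factor_row(2)[of i m a "\<lambda>i. q (real i - real l)"] sq that
    by (simp add: F_def)
  have Y2: "Y (Suc (m + i)) l = q (real i - real l) + q (real i + 1 - real l) - a * \<mu> 0"
    if "i < m" "l < m" for i l
    using Y[of "Suc (m + i)" l] sum_gear_factor_row(3)[of i m a "\<lambda>i. q (real i - real l)"] sq that
      cos_series_Suc_mod[of i m \<mu> "real l"]
    by (simp add: F_def q_def algebra_simps)
  have X: "X $$ (r, t) = (\<Sum>l<m. F $$ (t, l) * Y r l)" if "r < 2 * m + 1" "t < 2 * m + 1" for r t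
    unfolding X_def Y_def F_def[symmetric] using F that cos_circulant_carrier[of m \<mu>]
    by (subst index_mult_mat_sum[of _ "2 * m + 1" m _ "2 * m + 1"]) (auto simp: mult.commute)
  have X0: "X $$ (r, 0) = - a * (\<Sum>l<m. Y r l)" if "r < 2 * m + 1" for r
    using X[OF that, of 0] unfolding F_def sum_gear_factor_row by simp
  have X1: "X $$ (r, Suc j) = Y r j - a * (\<Sum>l<m. Y r l)" if "r < 2 * m + 1" "j < m" for r j
    using X[OF that(1), of "Suc j"] that(2) unfolding F_def sum_gear_factor_row(2)[OF that(2)] by simp
  have X2: "X $$ (r, Suc (m + j)) = Y r j + Y r (Suc j mod m) - a * (\<Sum>l<m. Y r l)"
    if "r < 2 * m + 1" "j < m" for r j
    using X[OF that(1), of "Suc (m + j)"] that(2) unfolding F_def sum_gear_factor_row(3)[OF that(2)] by simp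
  have S0: "(\<Sum>l<m. Y 0 l) = - a * real m * \<mu> 0" by (simp add: Y0)
  have S1: "(\<Sum>l<m. Y (Suc i) l) = \<mu> 0 - a * real m * \<mu> 0" if "i < m" for i
    using that by (simp add: Y1 sum_subtractf sq1)
  have S2: "(\<Sum>l<m. Y (Suc (m + i)) l) = 2 * \<mu> 0 - a * real m * \<mu> 0" if "i < m" for i
    using that by (simp add: Y2 sum_subtractf sum.distrib sq1)
  have mm: "Suc j mod m < m" for j using m by simp
  show "X $$ (0, 0) = c 0"
    by (simp add: X0 S0 c_def power2_eq_square)
  show "X $$ (0, Suc j) = c 1" if "j < m"
    using that by (simp add: X1 S0 Y0 c_def power2_eq_square)
  show "X $$ (0, Suc (m + j)) = c 2" if "j < m"
    using that by (simp add: X2 S0 Y0 mm c_def power2_eq_square)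
  show "X $$ (Suc i, 0) = c 1" if "i < m"
    using that by (simp add: X0 S1 c_def power2_eq_square algebra_simps)
  show "X $$ (Suc i, Suc j) = q (real i - real j) + c 2" if "i < m" "j < m"
    using that X1[of "Suc i" j] unfolding S1[OF that(1)] Y1[OF that]
    by (simp add: c_def power2_eq_square algebra_simps)
  show "X $$ (Suc i, Suc (m + j)) = q (real i - real j) + q (real i - real j - 1) + c 3"
    if "i < m" "j < m"
    using that X2[of "Suc i" j] q_next[of j "real i"]
    unfolding S1[OF that(1)] Y1[OF that] Y1[OF that(1) mm]
    by (simp add: c_def power2_eq_square algebra_simps)
  show "X $$ (Suc (m + i), 0) = c 2" if "i < m"
    using that X0[of "Suc (m + i)"] unfolding S2[OF that]
    by (simp add: c_def power2_eq_square algebra_simps)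
  show "X $$ (Suc (m + i), Suc j) = q (real i - real j) + q (real i - real j + 1) + c 3"
    if "i < m" "j < m"
    using that X1[of "Suc (m + i)" j] unfolding S2[OF that(1)] Y2[OF that]
    by (simp add: c_def power2_eq_square algebra_simps)
  show "X $$ (Suc (m + i), Suc (m + j))
      = 2 * q (real i - real j) + (q (real i - real j + 1) + q (real i - real j - 1)) + c 4"
    if "i < m" "j < m"
    using that X2[of "Suc (m + i)" j] q_next[of j "real i"] q_next[of j "real i + 1"]
    unfolding S2[OF that(1)] Y2[OF that] Y2[OF that(1) mm]
    by (simp add: c_def power2_eq_square algebra_simps)
qed

text \<open>By periodicity the reduced circulant offset may be replaced by
  \<open>real j - real i\<close>. The summand \<open>x\<close> is 0 for C and 1 for the shifted list
  of C tilde.\<close>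

lemma cos_freq_offset:
  assumes "i < m" "j < m"
  shows "cos (2 * pi * real k * (real ((j + m - i) mod m) + x) / real m)
    = cos (2 * pi * real k * (real j - real i + x) / real m)"
proof (cases "i \<le> j")
  case True
  hence "j + m - i = (j - i) + m" by simp
  hence "(j + m - i) mod m = j - i" using assms by (simp only: mod_add_self2) simp
  thus ?thesis using True by (simp add: of_nat_diff)
next
  case False
  hence "(j + m - i) mod m = j + m - i" using assms by simp
  hence "real ((j + m - i) mod m) + x = (real j - real i + x) + real m"
    using False assms by (simp add: of_nat_diff)
  thus ?thesis using cos_freq_periodic[of m k "real j - real i + x"] assms by (simp only:)
qed

lemma C_mat_index:
  assumes i: "i < m" and j: "j < m"
  shows "C_mat (Suc m) k $$ (i, j) = cos (2 * pi * real k * (real i - real j) / real m)"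
proof -
  let ?a = "[1] @ map (\<lambda>j. cos (2 * pi * real j * real k / (real (Suc m) - 1))) [1..<Suc m - 1]"
  have len: "length ?a = m" using i by simp
  have nth: "?a ! d = cos (2 * pi * real k * (real d + 0) / real m)" if "d < m" for d
    using that by (cases d) (auto simp: nth_append mult_ac)
  have "C_mat (Suc m) k $$ (i, j) = ?a ! ((j + m - i) mod m)"
    unfolding C_mat_def using circ_index[of i ?a j, unfolded len, OF i j] .
  also have "\<dots> = cos (2 * pi * real k * (real j - real i + 0) / real m)"
    unfolding cos_freq_offset[OF i j, symmetric] by (rule nth) (use i in simp)
  also have "2 * pi * real k * (real j - real i + 0) / real m = - (2 * pi * real k * (real i - real j) / real m)"
    by (simp add: algebra_simps minus_divide_left)
  finally show ?thesis by simp
qed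

text \<open>The defining list samples the same cosine as C one place later; its final 1 is the value
  at offset \<open>m\<close>. Evenness of the cosine then reverses the sign of the offset.\<close>

lemma C_tilde_mat_index:
  assumes i: "i < m" and j: "j < m"
  shows "C_tilde_mat (Suc m) k $$ (i, j) = cos (2 * pi * real k * (real i - real j - 1) / real m)"
proof -
  let ?a = "map (\<lambda>j. cos (2 * pi * real j * real k / (real (Suc m) - 1))) [1..<Suc m - 1] @ [1]"
  have len: "length ?a = m" using i by simp
  have one: "cos (2 * pi * real k * real m / real m) = 1"
    using cos_freq_periodic[of m k 0] i by simp
  have nth: "?a ! d = cos (2 * pi * real k * (real d + 1) / real m)" if "d < m" for d
  proof (cases "d = m - 1")
    case True
    hence "real d + 1 = real m" using that by simp
    thus ?thesis using True one by (simp add: nth_append)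
  next
    case False
    hence "d < m - 1" using that by simp
    thus ?thesis by (simp add: nth_append mult_ac add_ac)
  qed
  have "C_tilde_mat (Suc m) k $$ (i, j) = ?a ! ((j + m - i) mod m)"
    unfolding C_tilde_mat_def using circ_index[of i ?a j, unfolded len, OF i j] .
  also have "\<dots> = cos (2 * pi * real k * (real j - real i + 1) / real m)"
    unfolding cos_freq_offset[OF i j, symmetric] by (rule nth) (use i in simp)
  also have "2 * pi * real k * (real j - real i + 1) / real m = - (2 * pi * real k * (real i - real j - 1) / real m)"
    by (simp add: algebra_simps minus_divide_left)
  finally show ?thesis by simp
qed

lemma C_mat_carrier: "m > 0 \<Longrightarrow> C_mat (Suc m) k \<in> carrier_mat m m"
  unfolding C_mat_def by (rule circ_carrier) simp

lemma C_tilde_mat_carrier: "m > 0 \<Longrightarrow> C_tilde_mat (Suc m) k \<in> carrier_mat m m"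
  unfolding C_tilde_mat_def by (rule circ_carrier) simp

lemma gear_eig_phi:
  assumes "0 < k"
  shows "gear_eig m k = 1 + 4 * (phi (Suc m) k)\<^sup>2"
proof -
  have "cos (2 * pi * real k / real m) = 2 * (cos (pi * real k / real m))\<^sup>2 - 1"
    using cos_double_cos[of "pi * real k / real m"] by (simp add: mult_ac)
  thus ?thesis using assms by (simp add: gear_eig_def phi_def)
qed

lemma phi_pos:
  assumes "2 * k < m"
  shows "phi (Suc m) k > 0"
proof -
  have "pi * real k / real m < pi / 2"
  proof -
    have "pi * (2 * real k) < pi * real m" using assms by simp
    thus ?thesis using assms by (simp add: field_simps)
  qed
  moreover have "- (pi / 2) < pi * real k / real m" by (rule less_le_trans[of _ 0]) auto
  ultimately show ?thesis unfolding phi_def by (auto intro!: cos_gt_zero_pi)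
qed

text \<open>For the eigenvalue \<lambda> = 1 + 4 phi^2 one has 2 phi + 1 / (2 phi) = \<lambda> / (2
  phi). The blocks carrying the factor 1 / (4 phi^2) thus receive the weight 2 / (m \<lambda>^2),
  twice the weight of one frequency in the inverse square.\<close>

lemma B_mat_scale:
  assumes "0 < k" "2 * k < m"
  shows "2 / ((real (Suc m) - 1) * (2 * phi (Suc m) k + 1 / (2 * phi (Suc m) k))\<^sup>2)
    = 2 / real m * (4 * (phi (Suc m) k)\<^sup>2 / (gear_eig m k)\<^sup>2)"
proof -
  have "phi (Suc m) k \<noteq> 0" using phi_pos[OF assms(2)] by simp
  moreover from this have "2 * phi (Suc m) k + 1 / (2 * phi (Suc m) k) = gear_eig m k / (2 * phi (Suc m) k)"
    unfolding gear_eig_phi[OF assms(1)] by (simp add: field_simps power2_eq_square)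
  ultimately show ?thesis by (simp add: power_divide power_mult_distrib)
qed


text \<open>The matrix has rank one: it is \<open>s\<close> times v v' with v consisting of 1, then
  \<open>m\<close> copies of \<open>b\<close>, then \<open>m\<close> copies of
  \<open>c\<close>.\<close>

lemma A_mat_index:
  fixes m :: nat
  defines "x \<equiv> real m"
  defines "s \<equiv> 9 * x / (x + 5)\<^sup>2" and "b \<equiv> (x - 1) / (3 * x)" and "c \<equiv> - (x + 2) / (3 * x)"
  shows "A_mat (Suc m) \<in> carrier_mat (2 * m + 1) (2 * m + 1)"
    and "A_mat (Suc m) $$ (0, 0) = s"
    and "j < m \<Longrightarrow> A_mat (Suc m) $$ (0, Suc j) = s * b"
    and "j < m \<Longrightarrow> A_mat (Suc m) $$ (0, Suc (m + j)) = s * c"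
    and "i < m \<Longrightarrow> A_mat (Suc m) $$ (Suc i, 0) = s * b"
    and "i < m \<Longrightarrow> j < m \<Longrightarrow> A_mat (Suc m) $$ (Suc i, Suc j) = s * b\<^sup>2"
    and "i < m \<Longrightarrow> j < m \<Longrightarrow> A_mat (Suc m) $$ (Suc i, Suc (m + j)) = s * (b * c)"
    and "i < m \<Longrightarrow> A_mat (Suc m) $$ (Suc (m + i), 0) = s * c"
    and "i < m \<Longrightarrow> j < m \<Longrightarrow> A_mat (Suc m) $$ (Suc (m + i), Suc j) = s * (b * c)"
    and "i < m \<Longrightarrow> j < m \<Longrightarrow> A_mat (Suc m) $$ (Suc (m + i), Suc (m + j)) = s * c\<^sup>2"
proof -
  have n: "real (Suc m) - 1 = x" "real (Suc m) + 4 = x + 5" "real (Suc m) - 2 = x - 1"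
    "real (Suc m) + 1 = x + 2" "Suc m - 1 = m"
    by (simp_all add: x_def)
  have bc: "(x - 1)\<^sup>2 / (9 * x\<^sup>2) = b\<^sup>2" "(x + 2)\<^sup>2 / (9 * x\<^sup>2) = c\<^sup>2"
    "- (x - 1) * (x + 2) / (9 * x\<^sup>2) = b * c"
    by (simp_all add: b_def c_def power_divide power_mult_distrib power2_eq_square)
      (simp_all add: algebra_simps)
  define N where "N = nine_block_mat (1\<^sub>m 1) (b \<cdot>\<^sub>m ones_mat 1 m) (c \<cdot>\<^sub>m ones_mat 1 m)
      (b \<cdot>\<^sub>m ones_mat m 1) (b\<^sup>2 \<cdot>\<^sub>m J_mat m) ((b * c) \<cdot>\<^sub>m J_mat m)
      (c \<cdot>\<^sub>m ones_mat m 1) ((b * c) \<cdot>\<^sub>m J_mat m) (c\<^sup>2 \<cdot>\<^sub>m J_mat m)"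
  have A: "A_mat (Suc m) = s \<cdot>\<^sub>m N"
    unfolding A_mat_def n bc s_def[symmetric] b_def[symmetric] c_def[symmetric] N_def ..
  have o: "ones_mat p q \<in> carrier_mat p q" for p q by (simp add: ones_mat_def)
  note E = nine_block_mat_index[where m = m, OF one_carrier_mat smult_carrier_mat[OF o, of b] smult_carrier_mat[OF o, of c]
    smult_carrier_mat[OF o, of b] smult_carrier_mat[OF o, of "b\<^sup>2"] smult_carrier_mat[OF o, of "b * c"]
    smult_carrier_mat[OF o, of c] smult_carrier_mat[OF o, of "b * c"] smult_carrier_mat[OF o, of "c\<^sup>2"],
    folded N_def]
  note d = E(1)[THEN carrier_matD(1)] E(1)[THEN carrier_matD(2)]
  show "A_mat (Suc m) \<in> carrier_mat (2 * m + 1) (2 * m + 1)"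
    unfolding A by (rule smult_carrier_mat[OF E(1)])
  show "A_mat (Suc m) $$ (0, 0) = s"
    "j < m \<Longrightarrow> A_mat (Suc m) $$ (0, Suc j) = s * b"
    "j < m \<Longrightarrow> A_mat (Suc m) $$ (0, Suc (m + j)) = s * c"
    "i < m \<Longrightarrow> A_mat (Suc m) $$ (Suc i, 0) = s * b"
    "i < m \<Longrightarrow> j < m \<Longrightarrow> A_mat (Suc m) $$ (Suc i, Suc j) = s * b\<^sup>2"
    "i < m \<Longrightarrow> j < m \<Longrightarrow> A_mat (Suc m) $$ (Suc i, Suc (m + j)) = s * (b * c)"
    "i < m \<Longrightarrow> A_mat (Suc m) $$ (Suc (m + i), 0) = s * c"
    "i < m \<Longrightarrow> j < m \<Longrightarrow> A_mat (Suc m) $$ (Suc (m + i), Suc j) = s * (b * c)"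
    "i < m \<Longrightarrow> j < m \<Longrightarrow> A_mat (Suc m) $$ (Suc (m + i), Suc (m + j)) = s * c\<^sup>2"
    unfolding A by (simp_all add: d E(2-10) ones_mat_def)
qed

lemma H_mat_index:
  shows "H_mat (Suc m) \<in> carrier_mat (2 * m + 1) (2 * m + 1)"
    and "H_mat (Suc m) $$ (0, 0) = 0"
    and "j < m \<Longrightarrow> H_mat (Suc m) $$ (0, Suc j) = 0"
    and "j < m \<Longrightarrow> H_mat (Suc m) $$ (0, Suc (m + j)) = 0"
    and "i < m \<Longrightarrow> H_mat (Suc m) $$ (Suc i, 0) = 0"
    and "i < m \<Longrightarrow> j < m \<Longrightarrow> H_mat (Suc m) $$ (Suc i, Suc j) = (-1) ^ (i + j) / real m"
    and "i < m \<Longrightarrow> j < m \<Longrightarrow> H_mat (Suc m) $$ (Suc i, Suc (m + j)) = 0"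
    and "i < m \<Longrightarrow> H_mat (Suc m) $$ (Suc (m + i), 0) = 0"
    and "i < m \<Longrightarrow> j < m \<Longrightarrow> H_mat (Suc m) $$ (Suc (m + i), Suc j) = 0"
    and "i < m \<Longrightarrow> j < m \<Longrightarrow> H_mat (Suc m) $$ (Suc (m + i), Suc (m + j)) = 0"
proof -
  have n: "real (Suc m) - 1 = real m" "Suc m - 1 = m" by simp_all
  define N where "N = nine_block_mat (0\<^sub>m 1 1) (0\<^sub>m 1 m) (0\<^sub>m 1 m)
      (0\<^sub>m m 1) (R_mat (Suc m)) (0\<^sub>m m m) (0\<^sub>m m 1) (0\<^sub>m m m) (0\<^sub>m m m)"
  have H: "H_mat (Suc m) = (1 / real m) \<cdot>\<^sub>m N" unfolding H_mat_def n N_def ..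
  have R: "R_mat (Suc m) \<in> carrier_mat m m" by (simp add: R_mat_def)
  note z = zero_carrier_mat
  note E = nine_block_mat_index[where m = m, OF z z z z R z z z z, folded N_def]
  note d = E(1)[THEN carrier_matD(1)] E(1)[THEN carrier_matD(2)]
  show "H_mat (Suc m) \<in> carrier_mat (2 * m + 1) (2 * m + 1)"
    unfolding H by (rule smult_carrier_mat[OF E(1)])
  show "H_mat (Suc m) $$ (0, 0) = 0"
    "j < m \<Longrightarrow> H_mat (Suc m) $$ (0, Suc j) = 0"
    "j < m \<Longrightarrow> H_mat (Suc m) $$ (0, Suc (m + j)) = 0"
    "i < m \<Longrightarrow> H_mat (Suc m) $$ (Suc i, 0) = 0"
    "i < m \<Longrightarrow> j < m \<Longrightarrow> H_mat (Suc m) $$ (Suc i, Suc j) = (-1) ^ (i + j) / real m"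
    "i < m \<Longrightarrow> j < m \<Longrightarrow> H_mat (Suc m) $$ (Suc i, Suc (m + j)) = 0"
    "i < m \<Longrightarrow> H_mat (Suc m) $$ (Suc (m + i), 0) = 0"
    "i < m \<Longrightarrow> j < m \<Longrightarrow> H_mat (Suc m) $$ (Suc (m + i), Suc j) = 0"
    "i < m \<Longrightarrow> j < m \<Longrightarrow> H_mat (Suc m) $$ (Suc (m + i), Suc (m + j)) = 0"
    unfolding H by (simp_all add: d E(2-10) R_mat_def)
qed

lemma B_mat_index:
  assumes k: "0 < k" "2 * k < m"
  defines "\<gamma> \<equiv> (\<lambda>x. cos (2 * pi * real k * x / real m))"
    and "w \<equiv> 2 / real m * (1 / (gear_eig m k)\<^sup>2)"
  shows "B_mat (Suc m) k $$ (0, 0) = 0"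
    and "j < m \<Longrightarrow> B_mat (Suc m) k $$ (0, Suc j) = 0"
    and "j < m \<Longrightarrow> B_mat (Suc m) k $$ (0, Suc (m + j)) = 0"
    and "i < m \<Longrightarrow> B_mat (Suc m) k $$ (Suc i, 0) = 0"
    and "i < m \<Longrightarrow> j < m \<Longrightarrow> B_mat (Suc m) k $$ (Suc i, Suc j) = w * \<gamma> (real i - real j)"
    and "i < m \<Longrightarrow> j < m \<Longrightarrow> B_mat (Suc m) k $$ (Suc i, Suc (m + j))
           = w * (\<gamma> (real i - real j) + \<gamma> (real i - real j - 1))"
    and "i < m \<Longrightarrow> B_mat (Suc m) k $$ (Suc (m + i), 0) = 0"
    and "i < m \<Longrightarrow> j < m \<Longrightarrow> B_mat (Suc m) k $$ (Suc (m + i), Suc j)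
           = w * (\<gamma> (real i - real j) + \<gamma> (real i - real j + 1))"
    and "i < m \<Longrightarrow> j < m \<Longrightarrow> B_mat (Suc m) k $$ (Suc (m + i), Suc (m + j))
           = w * (gear_eig m k - 1) * \<gamma> (real i - real j)"
proof -
  have n: "Suc m - 1 = m" by simp
  have m: "m > 0" using k by simp
  define p where "p = phi (Suc m) k"
  have p: "p \<noteq> 0" using phi_pos[OF k(2)] by (simp add: p_def)
  define e where "e = 1 / (4 * p\<^sup>2)"
  define b where "b = 2 / real m * (4 * p\<^sup>2 / (gear_eig m k)\<^sup>2)"
  note C = C_mat_carrier[OF m, of k] and D = C_tilde_mat_carrier[OF m, of k]
  note Dt = transpose_carrier_mat[THEN iffD2, OF D]
  note CD = add_carrier_mat[OF D, of "C_mat (Suc m) k"] and CDt = add_carrier_mat[OF Dt, of "C_mat (Suc m) k"]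
  define N where "N = nine_block_mat (0\<^sub>m 1 1) (0\<^sub>m 1 m) (0\<^sub>m 1 m)
      (0\<^sub>m m 1) (e \<cdot>\<^sub>m C_mat (Suc m) k) (e \<cdot>\<^sub>m (C_mat (Suc m) k + C_tilde_mat (Suc m) k))
      (0\<^sub>m m 1) (e \<cdot>\<^sub>m (C_mat (Suc m) k + transpose_mat (C_tilde_mat (Suc m) k))) (C_mat (Suc m) k)"
  have B: "B_mat (Suc m) k = b \<cdot>\<^sub>m N"
    unfolding B_mat_def B_mat_scale[OF k] unfolding n N_def b_def e_def p_def ..
  note z = zero_carrier_mat
  note E = nine_block_mat_index[where m = m, OF z z z z smult_carrier_mat[OF C, of e] smult_carrier_mat[OF CD, of e]
      z smult_carrier_mat[OF CDt, of e] C, folded N_def]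
  note d = E(1)[THEN carrier_matD(1)] E(1)[THEN carrier_matD(2)]
  note dC = C[THEN carrier_matD(1)] C[THEN carrier_matD(2)] D[THEN carrier_matD(1)] D[THEN carrier_matD(2)]
  have be: "b * e = w" using p by (simp add: b_def e_def w_def)
  have bw: "b = w * (gear_eig m k - 1)"
    \<comment> \<open>The last block lacks the factor 1 / (4 phi^2), so it keeps 4 phi^2, which is
      the eigenvalue minus 1.\<close>
    by (simp add: b_def w_def gear_eig_phi[OF k(1)] p_def)
  have be': "b * (e * t) = w * t" for t using be by (simp add: mult.assoc[symmetric])
  \<comment> \<open>Needed for the transposed C tilde, whose indices are exchanged.\<close>
  have \<gamma>: "\<gamma> (real j - real i - 1) = \<gamma> (real i - real j + 1)" for i j :: nat
  proof -
    have "2 * pi * real k * (real j - real i - 1) / real m = - (2 * pi * real k * (real i - real j + 1) / real m)"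
      by (simp add: algebra_simps minus_divide_left)
    thus ?thesis unfolding \<gamma>_def by simp
  qed
  have Ce: "C_mat (Suc m) k $$ (i, j) = \<gamma> (real i - real j)"
    "C_tilde_mat (Suc m) k $$ (i, j) = \<gamma> (real i - real j - 1)" if "i < m" "j < m" for i j
    using C_mat_index[OF that] C_tilde_mat_index[OF that] by (simp_all only: \<gamma>_def)
  show "B_mat (Suc m) k $$ (0, 0) = 0"
    "j < m \<Longrightarrow> B_mat (Suc m) k $$ (0, Suc j) = 0"
    "j < m \<Longrightarrow> B_mat (Suc m) k $$ (0, Suc (m + j)) = 0"
    "i < m \<Longrightarrow> B_mat (Suc m) k $$ (Suc i, 0) = 0"
    "i < m \<Longrightarrow> B_mat (Suc m) k $$ (Suc (m + i), 0) = 0"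
    unfolding B by (simp_all add: d E(2-10))
  show "B_mat (Suc m) k $$ (Suc i, Suc j) = w * \<gamma> (real i - real j)" if "i < m" "j < m"
    using that unfolding B by (simp add: d dC E Ce be')
  show "B_mat (Suc m) k $$ (Suc i, Suc (m + j)) = w * (\<gamma> (real i - real j) + \<gamma> (real i - real j - 1))"
    if "i < m" "j < m"
    using that unfolding B by (simp add: d dC E Ce be')
  show "B_mat (Suc m) k $$ (Suc (m + i), Suc j) = w * (\<gamma> (real i - real j) + \<gamma> (real i - real j + 1))"
    if "i < m" "j < m"
    using that unfolding B by (simp add: d dC E Ce be' \<gamma>)
  show "B_mat (Suc m) k $$ (Suc (m + i), Suc (m + j)) = w * (gear_eig m k - 1) * \<gamma> (real i - real j)"
    if "i < m" "j < m"
    using that unfolding B by (simp add: d dC E Ce) (simp add: bw)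
qed

section \<open>Matching the frequency expansion with \<open>L_odd\<close>\<close>

lemma gear_eig_reflect: "0 < k \<Longrightarrow> k < m \<Longrightarrow> gear_eig m (m - k) = gear_eig m k"
proof -
  assume k: "0 < k" "k < m"
  hence "2 * pi * real (m - k) / real m = 2 * pi - 2 * pi * real k / real m"
    by (simp add: of_nat_diff field_simps)
  hence "cos (2 * pi * real (m - k) / real m) = cos (2 * pi * real k / real m)"
    by (simp add: cos_diff)
  with k show ?thesis by (simp add: gear_eig_def)
qed

text \<open>Each block is split into the contributions of frequency 0, frequency \<open>h\<close>
  and the paired frequencies. Together with the constants from centring, frequency 0 gives A.
  Frequency \<open>h\<close> alternates in sign, so it cancels wherever cyclic neighbours are added
  and survives only in the block where H is nonzero.\<close>

lemma L_odd_eq_sandwich: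
  assumes mh: "m = 2 * h" and h: "h \<ge> 2"
  shows "L_odd (Suc m) = gear_centred m * cos_circulant m (\<lambda>k. 1 / (gear_eig m k)\<^sup>2)
    * transpose_mat (gear_centred m)" (is "_ = ?X")
proof (rule eq_matI)
  have m: "m > 0" using mh h by simp
  define x where "x = real m"
  have x: "x > 0" using m by (simp add: x_def)
  define a where "a = 3 / (2 * x + 1)"
  define \<mu> where "\<mu> = (\<lambda>k. 1 / (gear_eig m k)\<^sup>2)"
  \<comment> \<open>\<open>S\<close> gives the entries of the summed B matrices between neighbours
    of the hub, \<open>S'\<close> those between outer vertices.\<close>
  define S where "S z = (\<Sum>k = 1..h - 1. 2 / x * \<mu> k * cos (2 * pi * real k * z / x))" for z
  define S' where "S' z = (\<Sum>k = 1..h - 1. 2 / x * \<mu> k * (gear_eig m k - 1) * cos (2 * pi * real k * z / x))" for z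
  define q where "q = cos_series m \<mu>"
  have eig0: "gear_eig m 0 = (x + 5) / (2 * x + 1)"
    using x unfolding gear_eig_def x_def[symmetric] by (simp add: field_simps)
  have eigh: "gear_eig m h = 1" using mh h by (simp add: gear_eig_def)
  have \<mu>0: "\<mu> 0 = (2 * x + 1)\<^sup>2 / (x + 5)\<^sup>2" unfolding \<mu>_def eig0 by (simp add: power_divide)
  have \<mu>h: "\<mu> h = 1" by (simp add: \<mu>_def eigh)
  have x1: "2 * x + 1 \<noteq> 0" using x by simp
  have a\<mu>: "a * \<mu> 0 = 3 * (2 * x + 1) / (x + 5)\<^sup>2" "a\<^sup>2 * \<mu> 0 = 9 / (x + 5)\<^sup>2"
    unfolding \<mu>0 a_def using x1 by (simp_all add: power2_eq_square divide_simps)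
  define c where "c d = a\<^sup>2 * real m * \<mu> 0 - d * a * \<mu> 0" for d
  have c: "c d = (9 * x - 3 * d * (2 * x + 1)) / (x + 5)\<^sup>2" for d
  proof -
    have "c d = x * (a\<^sup>2 * \<mu> 0) - d * (a * \<mu> 0)" by (simp add: c_def x_def)
    thus ?thesis unfolding a\<mu> by (simp add: diff_divide_distrib mult_ac)
  qed
  have qz: "q (of_int z) = \<mu> 0 / x + cos (pi * of_int z) / x + S (of_int z)" for z :: int
  proof -
    have "q (of_int z) = (\<mu> 0 + \<mu> h * cos (pi * of_int z)
       + 2 * (\<Sum>k = 1..h - 1. \<mu> k * cos (2 * pi * real k * of_int z / real m))) / real m"
      unfolding q_def using mh h by (intro cos_series_even) (auto simp: \<mu>_def gear_eig_reflect)
    thus ?thesis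
      by (simp add: S_def x_def \<mu>h add_divide_distrib sum_distrib_left sum_divide_distrib mult.assoc)
  qed
  \<comment> \<open>Adding the neighbours to twice the centre multiplies the spectrum by 2 + 2 cos
    (2 pi k / m). This is 4 at frequency 0, 0 at \<open>h\<close>, and
    \<open>gear_eig m k - 1\<close> at every other frequency below \<open>m\<close>.\<close>
  have q33: "2 * q (of_int z) + (q (of_int z + 1) + q (of_int z - 1)) = 4 * \<mu> 0 / x + S' (of_int z)" for z :: int
  proof -
    define \<nu> where "\<nu> k = 2 * \<mu> k + 1 * (\<mu> k * (2 * cos (2 * pi * real k / real m)))" for k
    have \<nu>: "\<nu> k = \<mu> k * (gear_eig m k - 1)" if "0 < k" for k
      using that by (simp add: \<nu>_def gear_eig_def algebra_simps)
    have "2 * q (of_int z) + (q (of_int z + 1) + q (of_int z - 1)) = cos_series m \<nu> (of_int z)"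
      unfolding \<nu>_def cos_series_lincomb[symmetric] q_def cos_series_neighbours by simp
    also have "\<dots> = (\<nu> 0 + \<nu> h * cos (pi * of_int z)
       + 2 * (\<Sum>k = 1..h - 1. \<nu> k * cos (2 * pi * real k * of_int z / real m))) / real m"
      using mh h by (intro cos_series_even) (auto simp: \<nu> \<mu>_def gear_eig_reflect)
    also have "\<nu> 0 = 4 * \<mu> 0" by (simp add: \<nu>_def)
    also have "\<nu> h = 0" using h by (simp add: \<nu> eigh)
    finally show ?thesis
      by (simp add: S'_def x_def \<nu> add_divide_distrib sum_distrib_left sum_divide_distrib mult.assoc)
  qed
  define X where "X = gear_factor m a * cos_circulant m \<mu> * transpose_mat (gear_factor m a)"
  have X: "?X = X" by (simp only: a_def x_def \<mu>_def X_def)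
  note XE = gear_factor_sandwich[where a = a and \<mu> = \<mu>, OF m, folded X_def c_def q_def]
  define BS where "BS r t = (\<Sum>k = 1..h - 1. B_mat (Suc m) k $$ (r, t))" for r t
  have kh: "0 < k" "2 * k < m" if "k \<in> {1..h - 1}" for k using that mh h by auto
  have BS0: "BS 0 0 = 0" "j < m \<Longrightarrow> BS 0 (Suc j) = 0" "j < m \<Longrightarrow> BS 0 (Suc (m + j)) = 0"
    "j < m \<Longrightarrow> BS (Suc j) 0 = 0" "j < m \<Longrightarrow> BS (Suc (m + j)) 0 = 0" for j
    unfolding BS_def by (auto intro!: sum.neutral simp: B_mat_index kh)
  have BS1: "BS (Suc i) (Suc j) = S (real i - real j)"
    "BS (Suc i) (Suc (m + j)) = S (real i - real j) + S (real i - real j - 1)"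
    "BS (Suc (m + i)) (Suc j) = S (real i - real j) + S (real i - real j + 1)"
    "BS (Suc (m + i)) (Suc (m + j)) = S' (real i - real j)" if "i < m" "j < m" for i j
    unfolding BS_def S_def S'_def sum.distrib[symmetric] x_def \<mu>_def
    by (intro sum.cong refl, simp only: B_mat_index(5,6,8,9)[OF kh that] distrib_left)+
  have L: "L_odd (Suc m) $$ (r, t) = A_mat (Suc m) $$ (r, t) + H_mat (Suc m) $$ (r, t) + BS r t"
    if "r < 2 * m + 1" "t < 2 * m + 1" for r t
  proof -
    \<comment> \<open>The summation range of \<open>L_odd\<close> contains exactly one frequency of
      each pair.\<close>
    have "(Suc m - 3) div 2 = h - 1" using mh h by simp
    thus ?thesis using that H_mat_index(1)[of m, THEN carrier_matD(1)] H_mat_index(1)[of m, THEN carrier_matD(2)]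
      unfolding L_odd_def BS_def by simp
  qed
  have int: "real i - real j = of_int (int i - int j)" "real i - real j - 1 = of_int (int i - int j - 1)"
    "real i - real j + 1 = of_int (int i - int j + 1)" for i j by simp_all
  have cosH: "cos (pi * of_int (int i - int j)) = (-1) ^ (i + j)" for i j
    by (simp add: right_diff_distrib cos_diff power_add)
  \<comment> \<open>A unit shift flips the alternating term, which therefore cancels in
    \<open>q23\<close> and \<open>q32\<close>.\<close>
  have cos1: "cos (pi * of_int (z - 1)) = - cos (pi * of_int z)"
    "cos (pi * of_int (z + 1)) = - cos (pi * of_int z)" for z :: int
    by (simp_all add: distrib_left right_diff_distrib cos_diff cos_add)
  have q22: "q (real i - real j) = \<mu> 0 / x + (-1) ^ (i + j) / x + S (real i - real j)" for i j
    unfolding int(1) qz cosH ..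
  have q23: "q (real i - real j) + q (real i - real j - 1) = 2 * \<mu> 0 / x + (S (real i - real j) + S (real i - real j - 1))" for i j
    unfolding int(2) unfolding int(1) qz cos1 by simp
  have q32: "q (real i - real j) + q (real i - real j + 1) = 2 * \<mu> 0 / x + (S (real i - real j) + S (real i - real j + 1))" for i j
    unfolding int(3) unfolding int(1) qz cos1 by simp
  have q33': "2 * q (real i - real j) + (q (real i - real j + 1) + q (real i - real j - 1)) = 4 * \<mu> 0 / x + S' (real i - real j)" for i j
    using q33[of "int i - int j"] by simp
  define s b d where "s = 9 * x / (x + 5)\<^sup>2" and "b = (x - 1) / (3 * x)" and "d = - (x + 2) / (3 * x)"
  note AE = A_mat_index(2-10)[where m = m, folded x_def, folded s_def b_def d_def]
  have x5: "(x + 5)\<^sup>2 \<noteq> 0" using x by simp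
  \<comment> \<open>All sides share the denominator (x + 5)^2, which can stay opaque as
    \<open>y\<close>. Clearing it leaves polynomial identities such as (2x + 1)^2 + 9x^2 - 6x(2x +
    1) = (x - 1)^2.\<close>
  have cA: "c 0 = s" "c 1 = s * b" "c 2 = s * d"
    "\<mu> 0 / x + c 2 = s * b\<^sup>2" "2 * \<mu> 0 / x + c 3 = s * (b * d)" "4 * \<mu> 0 / x + c 4 = s * d\<^sup>2"
  proof -
    define y where "y = (x + 5)\<^sup>2"
    have y: "y \<noteq> 0" using x5 by (simp add: y_def)
    show "c 0 = s" "c 1 = s * b" "c 2 = s * d"
      "\<mu> 0 / x + c 2 = s * b\<^sup>2" "2 * \<mu> 0 / x + c 3 = s * (b * d)" "4 * \<mu> 0 / x + c 4 = s * d\<^sup>2"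
      unfolding c \<mu>0 s_def b_def d_def y_def[symmetric] power_divide
      using x y by (simp_all add: divide_simps) (simp_all add: algebra_simps power2_eq_square)
  qed
  have X22: "X $$ (Suc i, Suc j) = s * b\<^sup>2 + (-1) ^ (i + j) / x + S (real i - real j)"
    and X23: "X $$ (Suc i, Suc (m + j)) = s * (b * d) + (S (real i - real j) + S (real i - real j - 1))"
    and X32: "X $$ (Suc (m + i), Suc j) = s * (b * d) + (S (real i - real j) + S (real i - real j + 1))"
    and X33: "X $$ (Suc (m + i), Suc (m + j)) = s * d\<^sup>2 + S' (real i - real j)"
    if "i < m" "j < m" for i j
    unfolding XE(5,6,8,9)[OF that] q23 q32 q33' unfolding q22 cA(4-6)[symmetric] by simp_all
  fix r t
  assume "r < dim_row ?X" "t < dim_col ?X"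
  hence r: "r < 2 * m + 1" and t: "t < 2 * m + 1" by (simp_all add: gear_factor_def)
  from r t show "L_odd (Suc m) $$ (r, t) = ?X $$ (r, t)"
    unfolding L[OF r t] X
    by (elim gear_index_cases)
      (simp_all add: AE H_mat_index XE(1-4,7) X22 X23 X32 X33 BS0 BS1 cA(1-3) x_def[symmetric])
qed (use A_mat_index(1)[of m] in \<open>simp_all add: L_odd_def gear_factor_def\<close>)

theorem theorem7:
  fixes n :: nat and P U :: "real mat"
  assumes "n \<ge> 5" and "odd n"
    and "P = 1\<^sub>m (2 * n - 1) - (1 / real (2 * n - 1)) \<cdot>\<^sub>m J_mat (2 * n - 1)"
    and "U = (- 1 / 2) \<cdot>\<^sub>m (P * E_mat n * P)"
  shows "L_odd n = mp_inverse U"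
proof -
  obtain h where "n = 2 * h + 1" using \<open>odd n\<close> by (elim oddE)
  moreover define m where "m = 2 * h"
  ultimately have n: "n = Suc m" and mh: "m = 2 * h" and h: "h \<ge> 2" and N: "2 * n - 1 = 2 * m + 1"
    using \<open>n \<ge> 5\<close> by auto
  have "m \<ge> 3" using mh h by simp
  hence "U = gear_centred m * transpose_mat (gear_centred m)"
    unfolding assms(4) n using assms(3) unfolding N by (rule U_eq_gear_gram)
  moreover have "L_odd n = gear_centred m * cos_circulant m (\<lambda>k. 1 / (gear_eig m k)\<^sup>2)
      * transpose_mat (gear_centred m)"
    unfolding n by (rule L_odd_eq_sandwich[OF mh h])
  moreover have "m > 0" using mh h by simp
  ultimately show ?thesis
    using mp_inverse_eqI[OF is_mp_inverse_gear] by simp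
qed

end
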